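(* Let $T$ be a rooted directed binary tree whose leaves are labeled by $[n]$, and let $O=[n]$ be the set of leaves of $T$. Then there is a weight vector $\omega\in\mathbb{R}^{\binom{n+1}{2}}$ and a sign vector $\tau\in\{\pm1\}^{\binom{n+1}{2}}$ such that $$I_{T,O}=\tau\cdot\mathrm{in}_\omega(I_{2,n}).$$
   Context: A rooted directed binary tree is a rooted tree with all edges directed away from the root in which every non-leaf vertex has exactly two children. For a directed acyclic graph $G$ (vertices ordered so that edges go from smaller to larger vertices), a collider is a pair of edges $i\to k$, $j\to k$ with the same head. For vertices $i,j$, $T(i,j)$ denotes the set of treks from $i$ to $j$: simple paths $P$ in (the underlying undirected graph of) $G$ from $i$ to $j$ containing no collider. Each trek goes from $i$ up to a topmost vertex $\mathrm{top}(P)$ and then down to $j$; $T(i,i)$ consists of the single empty trek, with top $i$. Let $\phi_G$ be the ring homomorphism from the polynomial ring in $\sigma_{ij}=\sigma_{ji}$, $i,j\in V(G)$, to $\mathbb{C}[a_i,\lambda_{ij}\mid i\in V(G),\ i\to j\in E(G)]$ given by $\sigma_{ij}\mapsto\sum_{P\in T(i,j)}a_{\mathrm{top}(P)}\prod_{k\to l\in P}\lambda_{kl}$. Set $I_G=\ker\phi_G$ and $I_{G,O}=I_G\cap\mathbb{C}[\sigma_{ij}\mid i,j\in O]$ for $O\subseteq V(G)$. The ideal of the Grassmannian of 2-planes in $\mathbb{C}^n$ in its Plücker embedding is $$I_{2,n}=\langle\sigma_{ij}\sigma_{kl}-\sigma_{ik}\sigma_{jl}+\sigma_{il}\sigma_{jk}\mid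 1\le i<j<k<l\le n\rangle\subset\mathbb{C}[\Sigma]=\mathbb{C}[\sigma_{ij}\mid 1\le i\le j\le n].$$ $\mathrm{in}_\omega(I)$ is the ideal generated by the initial forms (sums of the terms of extremal $\omega$-weight) of all elements of $I$. The sign vector $\tau$ acts by multiplying the coordinate $\sigma_{ij}$ by $\tau_{ij}$. *)

theory Defs
  imports
    "HOL.Complex"
    "HOL-Library.Poly_Mapping"
    "HOL-Algebra.Ideal"
    "Graph_Theory.Graph_Theory"
begin

section \<open>Polynomial rings over the complex numbers\<close>

text \<open>
  A monomial is a finitely supported exponent vector, and a polynomial is a finitely
  supported family of coefficients indexed by monomials. Multiplication is
  the convolution product of the library.
\<close>

type_synonym 'x mpoly = "('x \<Rightarrow>\<^sub>0 nat) \<Rightarrow>\<^sub>0 complex"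

definition Var :: "'x \<Rightarrow> 'x mpoly" where
  "Var x = Poly_Mapping.single (Poly_Mapping.single x 1) 1"

definition Const :: "complex \<Rightarrow> 'x mpoly" where
  "Const c = Poly_Mapping.single 0 c"

definition poly_ring :: "'x set \<Rightarrow> 'x mpoly ring" where
  "poly_ring X = \<lparr>carrier = {f. \<forall>m\<in>Poly_Mapping.keys f. Poly_Mapping.keys m \<subseteq> X},
     monoid.mult = (*), one = 1, zero = 0, add = (+)\<rparr>"

text \<open>The homomorphism of complex algebras that sends each variable \<open>x\<close> to \<open>s x\<close>:\<close>

definition subst_hom :: "('x \<Rightarrow> 'y mpoly) \<Rightarrow> 'x mpoly \<Rightarrow> 'y mpoly" where
  "subst_hom s f = (\<Sum>m\<in>Poly_Mapping.keys f. Const (Poly_Mapping.lookup f m) *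
     (\<Prod>x\<in>Poly_Mapping.keys m. s x ^ Poly_Mapping.lookup m x))"

section \<open>Rooted binary trees\<close>

text \<open>
  A rooted tree with all edges directed away from the root \<open>r\<close> (an arborescence): there is
  exactly one directed walk from \<open>r\<close> to each vertex. The constant \<^const>\<open>Digraph_Component.tree\<close>
  of the library is not suitable here, since it excludes directed cycles only.
\<close>

definition rooted_tree :: "'v pair_pre_digraph \<Rightarrow> 'v \<Rightarrow> bool" where
  "rooted_tree G r \<longleftrightarrow> pair_fin_digraph G \<and> r \<in> pverts G \<and>
     (\<forall>v\<in>pverts G. \<exists>!p. pre_digraph.awalk (with_proj G) r p v)"

definition leaves :: "'v pair_pre_digraph \<Rightarrow> 'v set" where
  "leaves G = {v \<in> pverts G. out_degree (with_proj G) v = 0}"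

definition rooted_binary_tree :: "'v pair_pre_digraph \<Rightarrow> bool" where
  "rooted_binary_tree G \<longleftrightarrow> (\<exists>r. rooted_tree G r) \<and>
     (\<forall>v \<in> pverts G - leaves G. out_degree (with_proj G) v = 2)"

section \<open>Treks\<close>

text \<open>
  A path in the underlying undirected graph is given by its list of vertices.
  \<open>path_edges G p\<close> are the edges of the path, oriented as they are in \<open>G\<close>.
\<close>

definition path_edges :: "'v pair_pre_digraph \<Rightarrow> 'v list \<Rightarrow> ('v \<times> 'v) set" where
  "path_edges G p =
     {(k, l) \<in> parcs G. (k, l) \<in> set (vwalk_arcs p) \<or> (l, k) \<in> set (vwalk_arcs p)}"

definition has_collider :: "'v pair_pre_digraph \<Rightarrow> 'v list \<Rightarrow> bool" where
  "has_collider G p \<longleftrightarrow>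
     (\<exists>i j k. i \<noteq> j \<and> (i, k) \<in> path_edges G p \<and> (j, k) \<in> path_edges G p)"

definition treks :: "'v pair_pre_digraph \<Rightarrow> 'v \<Rightarrow> 'v \<Rightarrow> 'v list set" where
  "treks G i j = {p. vpath p (with_proj (mk_symmetric (with_proj G))) \<and>
     hd p = i \<and> last p = j \<and> \<not> has_collider G p}"

text \<open>The topmost vertex of a trek is its only vertex that no edge of the trek points to.\<close>

definition trek_top :: "'v pair_pre_digraph \<Rightarrow> 'v list \<Rightarrow> 'v" where
  "trek_top G p = (THE v. v \<in> set p \<and> (\<forall>k. (k, v) \<notin> path_edges G p))"

section \<open>The trek ideal\<close>

text \<open>
  The variable \<open>\<sigma>\<^sub>i\<^sub>j = \<sigma>\<^sub>j\<^sub>i\<close> is represented by the pair \<open>(i, j)\<close> with \<open>i \<le> j\<close>. The order on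
  the vertices serves only to pick this representative and is not related to the direction
  of the edges; the treks from \<open>j\<close> to \<open>i\<close> are the reversed treks from \<open>i\<close> to \<open>j\<close>.
\<close>

definition sigma_vars :: "'v::linorder set \<Rightarrow> ('v \<times> 'v) set" where
  "sigma_vars S = {(i, j). i \<in> S \<and> j \<in> S \<and> i \<le> j}"

datatype 'v param = Avar 'v | Lvar 'v 'v

definition param_vars :: "'v pair_pre_digraph \<Rightarrow> 'v param set" where
  "param_vars G = Avar ` pverts G \<union> {Lvar i j | i j. (i, j) \<in> parcs G}"

definition trek_hom :: "'v pair_pre_digraph \<Rightarrow> ('v \<times> 'v) mpoly \<Rightarrow> 'v param mpoly" where
  "trek_hom G = subst_hom (\<lambda>(i, j). \<Sum>p\<in>treks G i j.
     Var (Avar (trek_top G p)) * (\<Prod>(k, l)\<in>path_edges G p. Var (Lvar k l)))"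

definition trek_ideal :: "'v::linorder pair_pre_digraph \<Rightarrow> ('v \<times> 'v) mpoly set" where
  "trek_ideal G =
     a_kernel (poly_ring (sigma_vars (pverts G))) (poly_ring (param_vars G)) (trek_hom G)"

definition observed_trek_ideal ::
    "'v::linorder pair_pre_digraph \<Rightarrow> 'v set \<Rightarrow> ('v \<times> 'v) mpoly set" where
  "observed_trek_ideal G S = trek_ideal G \<inter> carrier (poly_ring (sigma_vars S))"

section \<open>The Grassmannian of planes and initial ideals\<close>

definition grassmannian_ideal :: "nat \<Rightarrow> (nat \<times> nat) mpoly set" where
  "grassmannian_ideal n = Idl\<^bsub>poly_ring (sigma_vars {1..n})\<^esub>
     {Var (i, j) * Var (k, l) - Var (i, k) * Var (j, l) + Var (i, l) * Var (j, k) | i j k l.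
        1 \<le> i \<and> i < j \<and> j < k \<and> k < l \<and> l \<le> n}"

definition monom_weight :: "('x \<Rightarrow> real) \<Rightarrow> ('x \<Rightarrow>\<^sub>0 nat) \<Rightarrow> real" where
  "monom_weight \<omega> m = (\<Sum>x\<in>Poly_Mapping.keys m. \<omega> x * real (Poly_Mapping.lookup m x))"

text \<open>
  The initial form consists of the terms of maximal weight. The convention with minimal
  weight is the one for \<open>-\<omega>\<close>.
\<close>

definition initial_form :: "('x \<Rightarrow> real) \<Rightarrow> 'x mpoly \<Rightarrow> 'x mpoly" where
  "initial_form \<omega> f =
     (\<Sum>m\<in>{m \<in> Poly_Mapping.keys f.
            \<forall>m'\<in>Poly_Mapping.keys f. monom_weight \<omega> m' \<le> monom_weight \<omega> m}.
        Poly_Mapping.single m (Poly_Mapping.lookup f m))"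

definition initial_ideal :: "'x set \<Rightarrow> ('x \<Rightarrow> real) \<Rightarrow> 'x mpoly set \<Rightarrow> 'x mpoly set" where
  "initial_ideal X \<omega> I = Idl\<^bsub>poly_ring X\<^esub> (initial_form \<omega> ` I)"

definition sign_action :: "('x \<Rightarrow> complex) \<Rightarrow> 'x mpoly \<Rightarrow> 'x mpoly" where
  "sign_action \<tau> = subst_hom (\<lambda>x. Const (\<tau> x) * Var x)"

end

theory Submission
  imports Defs
begin

text \<open>
  In a rooted tree the trek between two leaves \<open>i\<close>, \<open>j\<close> is unique, so the observed trek ideal is
  the kernel of a monomial map. The exponents of the edge variables are determined by the leaf
  degrees and the tops, and the kernel is that of
  \<open>\<sigma>\<^sub>i\<^sub>j \<mapsto> t\<^sub>i t\<^sub>j a\<^bsub>lca(i,j)\<^esub>\<close>.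
  The Pluecker relations vanish under \<open>\<sigma>\<^sub>i\<^sub>j \<mapsto> t\<^sub>i t\<^sub>j (x\<^sub>i - x\<^sub>j)\<close>; taking for \<open>x\<^sub>i\<close> the sum of
  the \<open>a\<^sub>v\<close> over all \<open>v\<close> with \<open>i\<close> below the first child of \<open>v\<close>, and weighting \<open>a\<^sub>v\<close> by the number of
  vertices below \<open>v\<close>, the leading term of \<open>x\<^sub>i - x\<^sub>j\<close> is \<open>\<plusminus> a\<^bsub>lca(i,j)\<^esub>\<close>. Hence initial forms lie in the
  kernel of a sign twist of the monomial map. Conversely, two monomials with the same image
  are connected by binomials that are initial forms of Pluecker relations: cancel
  common variables, take a variable \<open>\<sigma>\<^sub>i\<^sub>j\<close> of the first monomial with \<open>lca(i,j)\<close> of least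
  weight, and create \<open>\<sigma>\<^sub>i\<^sub>j\<close> in the second one by at most two exchanges.
\<close>

section \<open>Monomials and substitution homomorphisms\<close>

text \<open>Binarity is what makes the two sides meet. The kernel of a monomial map is spanned by
  binomials, so the initial form of a Pluecker relation has to lose one of its three terms. Any
  three leaves have two equal joins and a strictly lower third one; hence for four leaves two terms
  tie for the largest weight and the third lies below. At a vertex with three children all three
  terms could tie. The signs arise because a Pluecker relation degenerates to a sum or a difference
  of monomials, while treks give differences only. The leading coefficient of
  \<open>x_i - x_j\<close> depends on the side of the join on which \<open>i\<close> lies, and this
  is the sign vector. A join of least weight is chosen because the current partner of
  \<open>i\<close> in the second monomial then meets \<open>i\<close> no lower than \<open>j\<close>
  does, so the two exchanged terms outweigh the third. The diagonal variables occur in no Pluecker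
  relation. They are sent to \<open>t_i^2 a_i\<close>, and as \<open>a_i\<close> for a leaf
  \<open>i\<close> occurs in no other image, they can only cancel.\<close>

lemma lookup_single_Suc_0:
  "Poly_Mapping.lookup (Poly_Mapping.single x (Suc 0)) y = (if y = x then 1 else 0)"
  by (simp add: lookup_single when_def)

lemma keys_add_nat:
  fixes m m' :: "'x \<Rightarrow>\<^sub>0 nat"
  shows "Poly_Mapping.keys (m + m') = Poly_Mapping.keys m \<union> Poly_Mapping.keys m'"
  by (auto simp: in_keys_iff lookup_add)

lemma keys_sum_nat:
  fixes h :: "'i \<Rightarrow> 'x \<Rightarrow>\<^sub>0 nat"
  assumes "finite A"
  shows "Poly_Mapping.keys (sum h A) = (\<Union>a\<in>A. Poly_Mapping.keys (h a))"
  using assms by (induction A rule: finite_induct) (auto simp: keys_add_nat)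

lemma monomial_split:
  fixes m :: "'x \<Rightarrow>\<^sub>0 nat"
  assumes "x \<in> Poly_Mapping.keys m"
  obtains m' where "m = m' + Poly_Mapping.single x 1"
proof
  show "m = (m - Poly_Mapping.single x 1) + Poly_Mapping.single x 1"
    using assms by (intro poly_mapping_eqI) (auto simp: lookup_add lookup_minus lookup_single_Suc_0 in_keys_iff)
qed

definition total_degree :: "('x \<Rightarrow>\<^sub>0 nat) \<Rightarrow> nat" where
  "total_degree m = (\<Sum>x\<in>Poly_Mapping.keys m. Poly_Mapping.lookup m x)"

lemma total_degree_superset:
  assumes "finite A" "Poly_Mapping.keys m \<subseteq> A"
  shows "total_degree m = (\<Sum>x\<in>A. Poly_Mapping.lookup m x)"
  unfolding total_degree_def using assms
  by (intro sum.mono_neutral_left) (auto simp: in_keys_iff)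

lemma total_degree_add: "total_degree (m + m') = total_degree m + total_degree m'"
  by (simp add: total_degree_superset[of "Poly_Mapping.keys m \<union> Poly_Mapping.keys m'"]
      keys_add_nat lookup_add sum.distrib)

lemma total_degree_single [simp]: "total_degree (Poly_Mapping.single x k) = k"
  by (simp add: total_degree_def)

lemma monomial_induct [case_names zero add]:
  fixes m :: "'x \<Rightarrow>\<^sub>0 nat"
  assumes "P 0" and "\<And>m x. P m \<Longrightarrow> P (m + Poly_Mapping.single x 1)"
  shows "P m"
proof (induction "total_degree m" arbitrary: m)
  case 0
  then have "Poly_Mapping.lookup m x = 0" for x
    by (cases "x \<in> Poly_Mapping.keys m") (auto simp: total_degree_def in_keys_iff)
  then have "m = 0"
    by (intro poly_mapping_eqI) simp
  with assms(1) show ?case by simp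
next
  case (Suc d)
  then have "Poly_Mapping.keys m \<noteq> {}"
    by (auto simp: total_degree_def)
  then obtain x m' where m: "m = m' + Poly_Mapping.single x 1"
    by (meson ex_in_conv monomial_split)
  with Suc.hyps(2) have "d = total_degree m'"
    by (simp add: total_degree_add)
  with Suc.hyps(1) assms(2) m show ?case by simp
qed

definition monomial_eval :: "('x \<Rightarrow> 'a::comm_monoid_mult) \<Rightarrow> ('x \<Rightarrow>\<^sub>0 nat) \<Rightarrow> 'a" where
  "monomial_eval s m = (\<Prod>x\<in>Poly_Mapping.keys m. s x ^ Poly_Mapping.lookup m x)"

lemma monomial_eval_superset:
  assumes "finite A" "Poly_Mapping.keys m \<subseteq> A"
  shows "monomial_eval s m = (\<Prod>x\<in>A. s x ^ Poly_Mapping.lookup m x)"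
  unfolding monomial_eval_def using assms
  by (intro prod.mono_neutral_left) (auto simp: in_keys_iff)

lemma monomial_eval_0 [simp]: "monomial_eval s 0 = 1"
  by (simp add: monomial_eval_def)

lemma monomial_eval_add: "monomial_eval s (m + m') = monomial_eval s m * monomial_eval s m'"
  by (simp add: monomial_eval_superset[of "Poly_Mapping.keys m \<union> Poly_Mapping.keys m'"]
      keys_add_nat lookup_add prod.distrib power_add)

lemma monomial_eval_single [simp]: "monomial_eval s (Poly_Mapping.single x k) = s x ^ k"
  by (simp add: monomial_eval_def)

lemma monomial_eval_cong:
  assumes "\<And>x. x \<in> Poly_Mapping.keys m \<Longrightarrow> s x = t x"
  shows "monomial_eval s m = monomial_eval t m"
  unfolding monomial_eval_def using assms by (intro prod.cong) auto

lemma monomial_eval_sign: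
  fixes \<tau> :: "'x \<Rightarrow> complex"
  assumes "\<And>x. \<tau> x \<in> {1, -1}"
  shows "monomial_eval \<tau> m * monomial_eval \<tau> m = 1"
proof (induction m rule: monomial_induct)
  case (add m x)
  with assms[of x] show ?case
    by (auto simp: monomial_eval_add)
qed simp

text \<open>The additive extension of \<open>E\<close> to exponent vectors, with repeated addition
  as multiplication by a natural number. A monomial map with exponents \<open>E\<close> sends the
  monomial \<open>m\<close> to \<open>expo E m\<close>, up to a coefficient.\<close>

definition expo :: "('x \<Rightarrow> 'y \<Rightarrow>\<^sub>0 nat) \<Rightarrow> ('x \<Rightarrow>\<^sub>0 nat) \<Rightarrow> 'y \<Rightarrow>\<^sub>0 nat" where
  "expo E m = (\<Sum>x\<in>Poly_Mapping.keys m. \<Sum>i<Poly_Mapping.lookup m x. E x)"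

lemma expo_superset:
  assumes "finite A" "Poly_Mapping.keys m \<subseteq> A"
  shows "expo E m = (\<Sum>x\<in>A. \<Sum>i<Poly_Mapping.lookup m x. E x)"
  unfolding expo_def using assms
  by (intro sum.mono_neutral_left) (auto simp: in_keys_iff)

lemma expo_0 [simp]: "expo E 0 = 0"
  by (simp add: expo_def)

lemma sum_lessThan_add_const:
  fixes c :: "'a::comm_monoid_add"
  shows "(\<Sum>i<a + b. c) = (\<Sum>i<a. c) + (\<Sum>i<b::nat. c)"
  by (induction b) (auto simp: ac_simps)

lemma expo_add: "expo E (m + m') = expo E m + expo E m'"
  by (simp add: expo_superset[of "Poly_Mapping.keys m \<union> Poly_Mapping.keys m'"]
      keys_add_nat lookup_add sum.distrib sum_lessThan_add_const)

lemma expo_single [simp]: "expo E (Poly_Mapping.single x (Suc 0)) = E x"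
  by (simp add: expo_def)

lemma lookup_expo:
  "Poly_Mapping.lookup (expo E m) y =
     (\<Sum>x\<in>Poly_Mapping.keys m. Poly_Mapping.lookup m x * Poly_Mapping.lookup (E x) y)"
  by (simp add: expo_def lookup_sum)

lemma keys_expo: "Poly_Mapping.keys (expo E m) = (\<Union>x\<in>Poly_Mapping.keys m. Poly_Mapping.keys (E x))"
proof -
  have "Poly_Mapping.keys (\<Sum>i<Poly_Mapping.lookup m x. E x) = Poly_Mapping.keys (E x)"
    if "x \<in> Poly_Mapping.keys m" for x
    using that by (subst keys_sum_nat) (auto simp: in_keys_iff intro!: exI[of _ 0])
  then show ?thesis
    by (simp add: expo_def keys_sum_nat)
qed

lemma monomial_eval_term:
  fixes c :: "'x \<Rightarrow> complex"
  shows "monomial_eval (\<lambda>x. Poly_Mapping.single (E x) (c x)) m =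
     Poly_Mapping.single (expo E m) (monomial_eval c m)"
proof (induction m rule: monomial_induct)
  case (add m x)
  then show ?case
    by (simp add: monomial_eval_add expo_add mult_single)
qed simp

lemma monom_weight_superset:
  assumes "finite A" "Poly_Mapping.keys m \<subseteq> A"
  shows "monom_weight \<omega> m = (\<Sum>x\<in>A. \<omega> x * real (Poly_Mapping.lookup m x))"
  unfolding monom_weight_def using assms
  by (intro sum.mono_neutral_left) (auto simp: in_keys_iff)

lemma monom_weight_0 [simp]: "monom_weight \<omega> 0 = 0"
  by (simp add: monom_weight_def)

lemma monom_weight_add: "monom_weight \<omega> (m + m') = monom_weight \<omega> m + monom_weight \<omega> m'"
  by (simp add: monom_weight_superset[of "Poly_Mapping.keys m \<union> Poly_Mapping.keys m'"]
      keys_add_nat lookup_add sum.distrib distrib_left)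

lemma monom_weight_single [simp]: "monom_weight \<omega> (Poly_Mapping.single x k) = \<omega> x * real k"
  by (simp add: monom_weight_def)

lemma Const_mult_single [simp]: "Const c * Poly_Mapping.single m d = Poly_Mapping.single m (c * d)"
  by (simp add: Const_def mult_single)

lemma Const_0 [simp]: "Const 0 = 0"
  by (simp add: Const_def)

lemma Const_1 [simp]: "Const 1 = 1"
  by (simp add: Const_def)

lemma Const_add: "Const (c + d) = Const c + Const d"
  by (simp add: Const_def single_add)

lemma Const_mult: "Const (c * d) = Const c * Const d"
  by (simp add: Const_def mult_single)

lemma lookup_Const_mult: "Poly_Mapping.lookup (Const c * f) m = c * Poly_Mapping.lookup f m"
  unfolding Const_def mult_map_scale_conv_mult[symmetric]
  by (simp add: Poly_Mapping.map.rep_eq when_def)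

section \<open>Substitution homomorphisms and the fibres of monomial maps\<close>

lemma subst_hom_eq:
  "subst_hom s f = (\<Sum>m\<in>Poly_Mapping.keys f. Const (Poly_Mapping.lookup f m) * monomial_eval s m)"
  by (simp add: subst_hom_def monomial_eval_def)

lemma subst_hom_superset:
  assumes "finite A" "Poly_Mapping.keys f \<subseteq> A"
  shows "subst_hom s f = (\<Sum>m\<in>A. Const (Poly_Mapping.lookup f m) * monomial_eval s m)"
  unfolding subst_hom_eq using assms
  by (intro sum.mono_neutral_left) (auto simp: in_keys_iff)

lemma subst_hom_0 [simp]: "subst_hom s 0 = 0"
  by (simp add: subst_hom_def)

lemma subst_hom_add: "subst_hom s (f + g) = subst_hom s f + subst_hom s g"
proof -
  have "Poly_Mapping.keys (f + g) \<subseteq> Poly_Mapping.keys f \<union> Poly_Mapping.keys g"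
    by (rule keys_add)
  then show ?thesis
    by (simp add: subst_hom_superset[of "Poly_Mapping.keys f \<union> Poly_Mapping.keys g"]
        lookup_add sum.distrib Const_add distrib_right)
qed

lemma subst_hom_single: "subst_hom s (Poly_Mapping.single m c) = Const c * monomial_eval s m"
  by (cases "c = 0") (auto simp: subst_hom_eq)

lemma subst_hom_Var [simp]: "subst_hom s (Var x) = s x"
  by (simp add: Var_def subst_hom_single)

lemma subst_hom_uminus: "subst_hom s (- f) = - subst_hom s f"
  using subst_hom_add[of s f "- f"] by (simp add: eq_neg_iff_add_eq_0 add.commute)

lemma subst_hom_diff: "subst_hom s (f - g) = subst_hom s f - subst_hom s g"
  using subst_hom_add[of s f "- g"] by (simp add: subst_hom_uminus)

lemma subst_hom_sum: "subst_hom s (\<Sum>a\<in>A. f a) = (\<Sum>a\<in>A. subst_hom s (f a))"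
  by (induction A rule: infinite_finite_induct) (auto simp: subst_hom_add)

lemma poly_expansion:
  "f = (\<Sum>m\<in>Poly_Mapping.keys f. Poly_Mapping.single m (Poly_Mapping.lookup f m))"
  by (intro poly_mapping_eqI)
    (auto simp: lookup_sum lookup_single when_def in_keys_iff)

lemma subst_hom_mult: "subst_hom s (f * g) = subst_hom s f * subst_hom s g"
proof -
  let ?T = "\<lambda>f m. Poly_Mapping.single m (Poly_Mapping.lookup f m)"
  have "f * g = (\<Sum>m\<in>Poly_Mapping.keys f. ?T f m) * (\<Sum>m\<in>Poly_Mapping.keys g. ?T g m)"
    using poly_expansion[of f] poly_expansion[of g] by simp
  also have "subst_hom s \<dots> = (\<Sum>m\<in>Poly_Mapping.keys f. \<Sum>m'\<in>Poly_Mapping.keys g.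
      subst_hom s (?T f m) * subst_hom s (?T g m'))"
    by (simp add: sum_product subst_hom_sum mult_single subst_hom_single monomial_eval_add
        Const_mult ac_simps)
  also have "\<dots> = subst_hom s (\<Sum>m\<in>Poly_Mapping.keys f. ?T f m) *
      subst_hom s (\<Sum>m\<in>Poly_Mapping.keys g. ?T g m)"
    by (simp add: sum_product subst_hom_sum)
  finally show ?thesis
    using poly_expansion[of f] poly_expansion[of g] by simp
qed

lemma subst_hom_cong:
  assumes "\<And>m x. m \<in> Poly_Mapping.keys f \<Longrightarrow> x \<in> Poly_Mapping.keys m \<Longrightarrow> s x = t x"
  shows "subst_hom s f = subst_hom t f"
  unfolding subst_hom_eq using assms
  by (intro sum.cong refl arg_cong2[where f = "(*)"] monomial_eval_cong) auto

lemma prod_Var: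
  "(\<Prod>a\<in>A. Var (h a)) = Poly_Mapping.single (\<Sum>a\<in>A. Poly_Mapping.single (h a) 1) 1"
  by (induction A rule: infinite_finite_induct) (auto simp: Var_def mult_single)

text \<open>The coefficient at \<open>e\<close> collects the fibre of \<open>e\<close>, so
  membership in the kernel can be tested fibre by fibre.\<close>

lemma lookup_subst_hom_term:
  "Poly_Mapping.lookup (subst_hom (\<lambda>x. Poly_Mapping.single (E x) (c x)) f) e =
     (\<Sum>m | m \<in> Poly_Mapping.keys f \<and> expo E m = e. Poly_Mapping.lookup f m * monomial_eval c m)"
proof -
  have "Poly_Mapping.lookup (subst_hom (\<lambda>x. Poly_Mapping.single (E x) (c x)) f) e =
      (\<Sum>m\<in>Poly_Mapping.keys f. if expo E m = e then Poly_Mapping.lookup f m * monomial_eval c m else 0)"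
    by (simp add: subst_hom_eq lookup_sum monomial_eval_term lookup_single when_def)
  also have "\<dots> = (\<Sum>m | m \<in> Poly_Mapping.keys f \<and> expo E m = e.
      Poly_Mapping.lookup f m * monomial_eval c m)"
    by (rule sum.inter_filter[symmetric]) simp
  finally show ?thesis .
qed

text \<open>A polynomial is in the kernel iff its coefficients sum to zero on every fibre, so only
  the partition of its monomials into fibres counts. The two maps may have different target
  rings.\<close>

lemma monomial_kernel_eqI:
  assumes "\<And>m m'. m \<in> Poly_Mapping.keys f \<Longrightarrow> m' \<in> Poly_Mapping.keys f \<Longrightarrow>
      expo E m = expo E m' \<longleftrightarrow> expo F m = expo F m'"
  shows "subst_hom (\<lambda>x. Poly_Mapping.single (E x) 1) f = 0 \<longleftrightarrow>
      subst_hom (\<lambda>x. Poly_Mapping.single (F x) 1) f = 0"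
proof -
  \<comment> \<open>One implication for arbitrary exponent maps; the other is its instance with the
    maps exchanged, which is why the types \<open>'d\<close> and \<open>'e\<close> have to be
    general.\<close>
  have main: "subst_hom (\<lambda>x. Poly_Mapping.single (F x) 1) f = 0"
    if eq: "\<And>m m'. m \<in> Poly_Mapping.keys f \<Longrightarrow> m' \<in> Poly_Mapping.keys f \<Longrightarrow>
        expo E m = expo E m' \<longleftrightarrow> expo F m = expo F m'"
      and ker: "subst_hom (\<lambda>x. Poly_Mapping.single (E x) 1) f = 0"
    for E :: "'a \<Rightarrow> 'd \<Rightarrow>\<^sub>0 nat" and F :: "'a \<Rightarrow> 'e \<Rightarrow>\<^sub>0 nat"
  proof (rule poly_mapping_eqI)
    fix e
    show "Poly_Mapping.lookup (subst_hom (\<lambda>x. Poly_Mapping.single (F x) 1) f) e = Poly_Mapping.lookup 0 e"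
    proof (cases "\<exists>m\<in>Poly_Mapping.keys f. expo F m = e")
      case True
      then obtain m0 where m0: "m0 \<in> Poly_Mapping.keys f" "expo F m0 = e" by blast
      with eq have "{m. m \<in> Poly_Mapping.keys f \<and> expo F m = e} =
          {m. m \<in> Poly_Mapping.keys f \<and> expo E m = expo E m0}" by auto
      moreover have "Poly_Mapping.lookup (subst_hom (\<lambda>x. Poly_Mapping.single (E x) 1) f) (expo E m0) = 0"
        using ker by simp
      ultimately show ?thesis
        unfolding lookup_subst_hom_term by (simp add: monomial_eval_def)
    next
      case False
      then have "{m. m \<in> Poly_Mapping.keys f \<and> expo F m = e} = {}" by auto
      then show ?thesis unfolding lookup_subst_hom_term by (simp only: sum.empty lookup_zero)
    qed
  qed
  from main[of E F] main[of F E] assms show ?thesis by blast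
qed

section \<open>Polynomial rings and initial forms\<close>

lemma poly_ring_simps [simp]:
  "monoid.mult (poly_ring X) = (*)" "monoid.one (poly_ring X) = 1"
  "ring.zero (poly_ring X) = 0" "ring.add (poly_ring X) = (+)"
  by (simp_all add: poly_ring_def)

lemma in_carrier_poly_ring:
  "f \<in> carrier (poly_ring X) \<longleftrightarrow> (\<forall>m\<in>Poly_Mapping.keys f. Poly_Mapping.keys m \<subseteq> X)"
  by (simp add: poly_ring_def)

lemma carrier_add:
  assumes "f \<in> carrier (poly_ring X)" "g \<in> carrier (poly_ring X)"
  shows "f + g \<in> carrier (poly_ring X)"
  using assms keys_add[of f g] unfolding in_carrier_poly_ring by blast

lemma carrier_uminus:
  assumes "f \<in> carrier (poly_ring X)"
  shows "- f \<in> carrier (poly_ring X)"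
  using assms unfolding in_carrier_poly_ring by (simp add: in_keys_iff)

lemma carrier_diff:
  assumes "f \<in> carrier (poly_ring X)" "g \<in> carrier (poly_ring X)"
  shows "f - g \<in> carrier (poly_ring X)"
  using carrier_add[OF assms(1) carrier_uminus[OF assms(2)]] by simp

lemma carrier_mult:
  assumes "f \<in> carrier (poly_ring X)" "g \<in> carrier (poly_ring X)"
  shows "f * g \<in> carrier (poly_ring X)"
  unfolding in_carrier_poly_ring
proof
  fix m assume "m \<in> Poly_Mapping.keys (f * g)"
  with keys_mult[of f g] obtain a b where
    "m = a + b" "a \<in> Poly_Mapping.keys f" "b \<in> Poly_Mapping.keys g" by blast
  with assms show "Poly_Mapping.keys m \<subseteq> X"
    by (auto simp: in_carrier_poly_ring keys_add_nat)
qed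

lemma carrier_single:
  "Poly_Mapping.keys m \<subseteq> X \<Longrightarrow> Poly_Mapping.single m c \<in> carrier (poly_ring X)"
  by (auto simp: in_carrier_poly_ring split: if_splits)

lemma carrier_Var: "x \<in> X \<Longrightarrow> Var x \<in> carrier (poly_ring X)"
  unfolding Var_def by (rule carrier_single) simp

lemma carrier_0 [simp]: "0 \<in> carrier (poly_ring X)"
  and carrier_1 [simp]: "1 \<in> carrier (poly_ring X)"
  by (simp_all add: in_carrier_poly_ring)

lemma poly_ring_cring: "cring (poly_ring X)"
proof (intro cringI abelian_groupI comm_monoidI)
  fix f assume "f \<in> carrier (poly_ring X)"
  then show "\<exists>g\<in>carrier (poly_ring X). g \<oplus>\<^bsub>poly_ring X\<^esub> f = \<zero>\<^bsub>poly_ring X\<^esub>"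
    by (intro bexI[of _ "- f"]) (auto simp: carrier_uminus)
qed (auto simp: carrier_add carrier_mult algebra_simps)

text \<open>Kernels in this form serve as upper bounds: an ideal given by generators lies in every
  such kernel that contains the generators.\<close>

lemma subst_hom_kernel_ideal:
  "ideal {f \<in> carrier (poly_ring X). subst_hom s f = 0} (poly_ring X)"
proof (rule idealI)
  show "ring (poly_ring X)"
    using poly_ring_cring by (rule cring.axioms(1))
  show "subgroup {f \<in> carrier (poly_ring X). subst_hom s f = 0} (add_monoid (poly_ring X))"
  proof (rule group.subgroupI)
    show "Group.group (add_monoid (poly_ring X))"
      by (intro abelian_group.a_group ring.is_abelian_group cring.axioms(1) poly_ring_cring)
    fix f assume f: "f \<in> {f \<in> carrier (poly_ring X). subst_hom s f = 0}"
    have "inv\<^bsub>add_monoid (poly_ring X)\<^esub> f = - f"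
    proof (rule group.inv_equality)
      show "Group.group (add_monoid (poly_ring X))"
        by (intro abelian_group.a_group ring.is_abelian_group cring.axioms(1) poly_ring_cring)
    qed (use f in \<open>auto simp: carrier_uminus\<close>)
    with f show "inv\<^bsub>add_monoid (poly_ring X)\<^esub> f \<in> {f \<in> carrier (poly_ring X). subst_hom s f = 0}"
      by (simp add: carrier_uminus subst_hom_uminus)
  qed (auto simp: carrier_add subst_hom_add intro!: exI[of _ 0])
qed (auto simp: carrier_mult subst_hom_mult)

lemma ideal_poly_ring_closed:
  assumes "ideal J (poly_ring X)"
  shows ideal_poly_ring_0: "0 \<in> J"
    and ideal_poly_ring_add: "\<And>f g. f \<in> J \<Longrightarrow> g \<in> J \<Longrightarrow> f + g \<in> J"
    and ideal_poly_ring_mult: "\<And>f g. f \<in> J \<Longrightarrow> g \<in> carrier (poly_ring X) \<Longrightarrow> g * f \<in> J"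
    and ideal_poly_ring_uminus: "\<And>f. f \<in> J \<Longrightarrow> - f \<in> J"
proof -
  interpret ideal J "poly_ring X" by (rule assms)
  show "0 \<in> J" using additive_subgroup.zero_closed[OF is_additive_subgroup] by simp
  show "f + g \<in> J" if "f \<in> J" "g \<in> J" for f g 
    using additive_subgroup.a_closed[OF is_additive_subgroup that] by simp
  show *: "g * f \<in> J" if "f \<in> J" "g \<in> carrier (poly_ring X)" for f g
    using I_l_closed[OF that] by simp
  show "- f \<in> J" if "f \<in> J" for f
    using *[OF that, of "- 1"] by (simp add: carrier_uminus)
qed

section \<open>Leading parts with respect to a weight\<close>

text \<open>The part \<open>g\<close> may be 0. This makes the relation closed under sums, in which
  top terms can cancel, and treats a polynomial below the level \<open>w\<close> as one with leading
  part 0.\<close>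

definition leading :: "('x \<Rightarrow> real) \<Rightarrow> real \<Rightarrow> 'x mpoly \<Rightarrow> 'x mpoly \<Rightarrow> bool" where
  "leading \<omega> w f g \<longleftrightarrow> (\<forall>m\<in>Poly_Mapping.keys g. monom_weight \<omega> m = w) \<and>
     (\<forall>m\<in>Poly_Mapping.keys (f - g). monom_weight \<omega> m < w)"

lemma leading_0 [simp]: "leading \<omega> w 0 0"
  by (simp add: leading_def)

lemma leading_1 [simp]: "leading \<omega> 0 1 1"
  by (simp add: leading_def)

lemma leading_add:
  assumes "leading \<omega> w f g" "leading \<omega> w f' g'"
  shows "leading \<omega> w (f + f') (g + g')"
proof -
  have *: "f + f' - (g + g') = (f - g) + (f' - g')" by simp
  from keys_add[of g g'] keys_add[of "f - g" "f' - g'"]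
  have "Poly_Mapping.keys (g + g') \<subseteq> Poly_Mapping.keys g \<union> Poly_Mapping.keys g'"
    "Poly_Mapping.keys (f + f' - (g + g')) \<subseteq> Poly_Mapping.keys (f - g) \<union> Poly_Mapping.keys (f' - g')"
    unfolding * by auto
  with assms show ?thesis unfolding leading_def by blast
qed

lemma leading_sum:
  assumes "\<And>a. a \<in> A \<Longrightarrow> leading \<omega> w (f a) (g a)"
  shows "leading \<omega> w (sum f A) (sum g A)"
  using assms by (induction A rule: infinite_finite_induct) (auto simp: leading_add)

lemma leading_mult:
  assumes "leading \<omega> w f g" "leading \<omega> w' f' g'"
  shows "leading \<omega> (w + w') (f * f') (g * g')"
proof -
  have *: "\<exists>a\<in>Poly_Mapping.keys p. \<exists>b\<in>Poly_Mapping.keys q. monom_weight \<omega> m = monom_weight \<omega> a + monom_weight \<omega> b"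
    if "m \<in> Poly_Mapping.keys (p * q)" for p q :: "'a mpoly" and m
  proof -
    from that keys_mult[of p q] obtain a b where
      "m = a + b" "a \<in> Poly_Mapping.keys p" "b \<in> Poly_Mapping.keys q" by blast
    then show ?thesis by (auto simp: monom_weight_add)
  qed
  have lead: "monom_weight \<omega> m = w + w'" if "m \<in> Poly_Mapping.keys (g * g')" for m
    using *[OF that] assms unfolding leading_def by auto
  have low: "monom_weight \<omega> m < w + w'" if "m \<in> Poly_Mapping.keys (f * f' - g * g')" for m
  proof -
    \<comment> \<open>Each of the three products has a factor strictly below its level,
      \<open>f - g\<close> or \<open>f' - g'\<close>, and no factor above its level.\<close>
    have "f * f' - g * g' = ((f - g) * (f' - g') + g * (f' - g')) + (f - g) * g'"
      by (simp add: algebra_simps)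
    with that consider "m \<in> Poly_Mapping.keys ((f - g) * (f' - g'))"
      | "m \<in> Poly_Mapping.keys (g * (f' - g'))" | "m \<in> Poly_Mapping.keys ((f - g) * g')"
      using keys_add[of "(f - g) * (f' - g')" "g * (f' - g')"]
        keys_add[of "(f - g) * (f' - g') + g * (f' - g')" "(f - g) * g'"] by auto
    then show ?thesis
    proof cases
      case 1
      with * obtain a b where "a \<in> Poly_Mapping.keys (f - g)" "b \<in> Poly_Mapping.keys (f' - g')"
        "monom_weight \<omega> m = monom_weight \<omega> a + monom_weight \<omega> b" by blast
      moreover from this assms have "monom_weight \<omega> a < w" "monom_weight \<omega> b < w'"
        by (auto simp: leading_def)
      ultimately show ?thesis by simp
    next
      case 2
      with * obtain a b where "a \<in> Poly_Mapping.keys g" "b \<in> Poly_Mapping.keys (f' - g')"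
        "monom_weight \<omega> m = monom_weight \<omega> a + monom_weight \<omega> b" by blast
      moreover from this assms have "monom_weight \<omega> a = w" "monom_weight \<omega> b < w'"
        by (auto simp: leading_def)
      ultimately show ?thesis by simp
    next
      case 3
      with * obtain a b where "a \<in> Poly_Mapping.keys (f - g)" "b \<in> Poly_Mapping.keys g'"
        "monom_weight \<omega> m = monom_weight \<omega> a + monom_weight \<omega> b" by blast
      moreover from this assms have "monom_weight \<omega> a < w" "monom_weight \<omega> b = w'"
        by (auto simp: leading_def)
      ultimately show ?thesis by simp
    qed
  qed
  from lead low show ?thesis by (simp add: leading_def)
qed

lemma leading_Const_mult:
  assumes "leading \<omega> w f g"
  shows "leading \<omega> w (Const c * f) (Const c * g)"
proof -
  have "Const c * f - Const c * g = Const c * (f - g)" by (simp add: algebra_simps)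
  with assms show ?thesis
    by (auto simp: leading_def in_keys_iff lookup_Const_mult)
qed

lemma leading_low:
  assumes "leading \<omega> w f g" "w < w'"
  shows "leading \<omega> w' f 0"
proof -
  have "monom_weight \<omega> m < w'" if "m \<in> Poly_Mapping.keys f" for m
  proof -
    have "m \<in> Poly_Mapping.keys g \<or> m \<in> Poly_Mapping.keys (f - g)"
      using that by (auto simp: in_keys_iff lookup_minus)
    with assms show ?thesis unfolding leading_def by (metis order.strict_trans)
  qed
  then show ?thesis by (simp add: leading_def)
qed

text \<open>Any monomial of \<open>g\<close> would have weight equal to \<open>w\<close> and also
  less than \<open>w\<close>.\<close>

lemma leading_zero_unique:
  assumes "leading \<omega> w 0 g"
  shows "g = 0"
proof -
  have "m \<notin> Poly_Mapping.keys g" for m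
  proof
    assume "m \<in> Poly_Mapping.keys g"
    moreover from this have "m \<in> Poly_Mapping.keys (0 - g)" by (simp add: in_keys_iff)
    ultimately show False using assms unfolding leading_def by fastforce
  qed
  then have "Poly_Mapping.keys g = {}" by blast
  then show ?thesis by simp
qed

text \<open>The weight of a variable is the level of its image, so the weight on the source is
  pulled back along the substitution.\<close>

lemma leading_monomial_eval:
  assumes "\<And>x. x \<in> Poly_Mapping.keys m \<Longrightarrow> leading u (\<omega> x) (s x) (t x)"
  shows "leading u (monom_weight \<omega> m) (monomial_eval s m) (monomial_eval t m)"
  using assms
proof (induction m rule: monomial_induct)
  case (add m x)
  then have "leading u (monom_weight \<omega> m) (monomial_eval s m) (monomial_eval t m)"
    "leading u (\<omega> x) (s x) (t x)"
    by (auto simp: keys_add_nat)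
  from leading_mult[OF this] show ?case
    by (simp add: monomial_eval_add monom_weight_add)
qed simp

lemma lookup_initial_form:
  "Poly_Mapping.lookup (initial_form \<omega> f) m =
     (if m \<in> Poly_Mapping.keys f \<and> (\<forall>m'\<in>Poly_Mapping.keys f. monom_weight \<omega> m' \<le> monom_weight \<omega> m)
      then Poly_Mapping.lookup f m else 0)"
  unfolding initial_form_def by (auto simp: lookup_sum lookup_single when_def)

lemma leading_initial_form:
  obtains w where "leading \<omega> w f (initial_form \<omega> f)"
proof (cases "f = 0")
  case True
  then have "initial_form \<omega> f = 0" by (simp add: initial_form_def)
  with True that show ?thesis by simp
next
  case False
  define w where "w = Max (monom_weight \<omega> ` Poly_Mapping.keys f)"
  have le: "monom_weight \<omega> m \<le> w" if "m \<in> Poly_Mapping.keys f" for m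
    unfolding w_def using that by simp
  have "w \<in> monom_weight \<omega> ` Poly_Mapping.keys f"
    unfolding w_def using False by (intro Max_in) auto
  then obtain m0 where m0: "m0 \<in> Poly_Mapping.keys f" "monom_weight \<omega> m0 = w" by blast
  have "leading \<omega> w f (initial_form \<omega> f)"
    unfolding leading_def
  proof (intro conjI ballI)
    fix m assume "m \<in> Poly_Mapping.keys (initial_form \<omega> f)"
    then have "m \<in> Poly_Mapping.keys f" "\<forall>m'\<in>Poly_Mapping.keys f. monom_weight \<omega> m' \<le> monom_weight \<omega> m"
      by (auto simp: in_keys_iff lookup_initial_form split: if_splits)
    with m0 le show "monom_weight \<omega> m = w" by force
  next
    fix m assume "m \<in> Poly_Mapping.keys (f - initial_form \<omega> f)"
    then have m: "m \<in> Poly_Mapping.keys f"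
      "\<not> (\<forall>m'\<in>Poly_Mapping.keys f. monom_weight \<omega> m' \<le> monom_weight \<omega> m)"
      by (auto simp: in_keys_iff lookup_minus lookup_initial_form split: if_split_asm)
    then obtain m' where "m' \<in> Poly_Mapping.keys f" "monom_weight \<omega> m < monom_weight \<omega> m'" by force
    with le[of m'] show "monom_weight \<omega> m < w" by simp
  qed
  with that show ?thesis .
qed

text \<open>A nonzero \<open>g\<close> certifies that the level \<open>w\<close> is attained and
  hence is the maximal weight in \<open>f\<close>.\<close>

lemma initial_form_eqI:
  assumes "leading \<omega> w f g" "g \<noteq> 0"
  shows "initial_form \<omega> f = g"
proof (rule poly_mapping_eqI)
  fix m
  from assms(2) obtain m0 where m0: "m0 \<in> Poly_Mapping.keys g" by fastforce
  have eq: "Poly_Mapping.lookup f m = Poly_Mapping.lookup g m" if "monom_weight \<omega> m \<ge> w" for m :: "'a \<Rightarrow>\<^sub>0 nat"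
  proof (rule ccontr)
    assume "Poly_Mapping.lookup f m \<noteq> Poly_Mapping.lookup g m"
    then have "m \<in> Poly_Mapping.keys (f - g)" by (simp add: in_keys_iff lookup_minus)
    with assms(1) that show False unfolding leading_def by force
  qed
  have zero: "m \<notin> Poly_Mapping.keys g" if "monom_weight \<omega> m \<noteq> w" for m
    using assms(1) that unfolding leading_def by blast
  have m0': "m0 \<in> Poly_Mapping.keys f" "monom_weight \<omega> m0 = w"
    using m0 eq[of m0] zero[of m0] by (cases "monom_weight \<omega> m0 = w"; auto simp: in_keys_iff)+
  have le: "monom_weight \<omega> m' \<le> w" if "m' \<in> Poly_Mapping.keys f" for m'
    using that eq[of m'] zero[of m'] by (force simp: in_keys_iff)
  show "Poly_Mapping.lookup (initial_form \<omega> f) m = Poly_Mapping.lookup g m"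
  proof (cases "monom_weight \<omega> m = w")
    case True
    with eq[of m] le show ?thesis by (auto simp: lookup_initial_form in_keys_iff)
  next
    case False
    then have "Poly_Mapping.lookup g m = 0" using zero[of m] by (simp add: in_keys_iff)
    moreover have "monom_weight \<omega> m < w" if "m \<in> Poly_Mapping.keys f"
      using le[OF that] False by simp
    ultimately show ?thesis using m0' by (fastforce simp: lookup_initial_form)
  qed
qed

lemma carrier_initial_form:
  assumes "f \<in> carrier (poly_ring X)"
  shows "initial_form \<omega> f \<in> carrier (poly_ring X)"
proof -
  have "Poly_Mapping.keys (initial_form \<omega> f) \<subseteq> Poly_Mapping.keys f"
    by (auto simp: in_keys_iff lookup_initial_form split: if_splits)
  with assms show ?thesis unfolding in_carrier_poly_ring by blast
qed

text \<open>At the level of the maximal weight of \<open>f\<close>, the leading part of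
  \<open>subst_hom s f\<close> is \<open>subst_hom t\<close> of the initial form. A relation among
  the \<open>s x\<close> thus degenerates to a relation among the \<open>t x\<close>.\<close>

lemma subst_hom_initial_form_eq_0:
  assumes lead: "\<And>x. x \<in> X \<Longrightarrow> leading u (\<omega> x) (s x) (t x)"
    and f: "f \<in> carrier (poly_ring X)" "subst_hom s f = 0"
  shows "subst_hom t (initial_form \<omega> f) = 0"
proof -
  define g where "g = initial_form \<omega> f"
  have sub: "Poly_Mapping.keys g \<subseteq> Poly_Mapping.keys f"
    by (auto simp: g_def in_keys_iff lookup_initial_form split: if_splits)
  have eq: "Poly_Mapping.lookup g m = Poly_Mapping.lookup f m" if "m \<in> Poly_Mapping.keys g" for m
    using that by (auto simp: g_def in_keys_iff lookup_initial_form split: if_splits)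
  obtain w where w: "leading \<omega> w f g"
    unfolding g_def by (rule leading_initial_form)
  have "leading u w (Const (Poly_Mapping.lookup f m) * monomial_eval s m)
      (Const (Poly_Mapping.lookup g m) * monomial_eval t m)" if m: "m \<in> Poly_Mapping.keys f" for m
  proof -
    have lm: "leading u (monom_weight \<omega> m) (Const (Poly_Mapping.lookup f m) * monomial_eval s m)
        (Const (Poly_Mapping.lookup f m) * monomial_eval t m)"
      using lead f(1) m
      by (intro leading_Const_mult leading_monomial_eval) (auto simp: in_carrier_poly_ring)
    show ?thesis
    proof (cases "m \<in> Poly_Mapping.keys g")
      case True
      with w lm eq show ?thesis by (simp add: leading_def)
    next
      case False
      \<comment> \<open>Terms of \<open>f\<close> outside the initial form have lower weight and
        contribute 0 at level \<open>w\<close>.\<close>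
      then have 0: "Poly_Mapping.lookup g m = 0" by (simp add: in_keys_iff)
      with m have "m \<in> Poly_Mapping.keys (f - g)" by (simp add: in_keys_iff lookup_minus)
      with w have "monom_weight \<omega> m < w" by (simp add: leading_def)
      from leading_low[OF lm this] 0 show ?thesis by simp
    qed
  qed
  then have "leading u w (subst_hom s f) (subst_hom t g)"
    unfolding subst_hom_eq[of s] subst_hom_superset[OF finite_keys sub] by (rule leading_sum)
  with f(2) have "leading u w 0 (subst_hom t g)" by simp
  then show ?thesis unfolding g_def by (rule leading_zero_unique)
qed

section \<open>The initial ideal for an ultrametric of joins\<close>

lemma single_eq_0_iff: "Poly_Mapping.single m c = 0 \<longleftrightarrow> c = 0"
proof
  assume "Poly_Mapping.single m c = 0"
  then have "Poly_Mapping.lookup (Poly_Mapping.single m c) m = 0" by simp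
  then show "c = 0" by (simp only: lookup_single_eq)
qed simp

section \<open>Pluecker coordinates and relations for indices in any order\<close>

definition edge :: "nat \<Rightarrow> nat \<Rightarrow> nat \<times> nat" where
  "edge i j = (if i \<le> j then (i, j) else (j, i))"

lemma edge_commute: "edge i j = edge j i"
  by (simp add: edge_def)

lemma edge_eq_iff: "edge i j = edge k l \<longleftrightarrow> (i = k \<and> j = l) \<or> (i = l \<and> j = k)"
  by (auto simp: edge_def)

definition edge_mon :: "nat \<Rightarrow> nat \<Rightarrow> nat \<times> nat \<Rightarrow>\<^sub>0 nat" where
  "edge_mon i j = Poly_Mapping.single (edge i j) 1"

lemma edge_mon_commute: "edge_mon i j = edge_mon j i"
  by (simp add: edge_mon_def edge_commute)

lemma keys_edge_mon [simp]: "Poly_Mapping.keys (edge_mon i j) = {edge i j}"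
  by (simp add: edge_mon_def)

lemma edge_in_sigma_vars: "edge i j \<in> sigma_vars V \<longleftrightarrow> i \<in> V \<and> j \<in> V"
  by (auto simp: edge_def sigma_vars_def)

definition edge_sign :: "nat \<Rightarrow> nat \<Rightarrow> complex" where
  "edge_sign i j = (if i < j then 1 else -1)"

lemma edge_sign_swap: "i \<noteq> j \<Longrightarrow> edge_sign j i = - edge_sign i j"
  by (auto simp: edge_sign_def)

text \<open>The antisymmetric coordinate with \<open>p_ij = - p_ji\<close>, whereas the variables
  are symmetric. With it the relation can be stated for four indices in any order.\<close>

definition pluecker :: "nat \<Rightarrow> nat \<Rightarrow> (nat \<times> nat) mpoly" where
  "pluecker i j = Poly_Mapping.single (edge_mon i j) (edge_sign i j)"

lemma pluecker_swap: "i \<noteq> j \<Longrightarrow> pluecker j i = - pluecker i j"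
  by (simp add: pluecker_def edge_sign_swap[of i j] edge_mon_commute[of j i] single_uminus)

lemma pluecker_less: "i < j \<Longrightarrow> pluecker i j = Var (i, j)"
  by (simp add: pluecker_def edge_sign_def edge_mon_def edge_def Var_def)

definition pluecker_relation :: "nat \<Rightarrow> nat \<Rightarrow> nat \<Rightarrow> nat \<Rightarrow> (nat \<times> nat) mpoly" where
  "pluecker_relation a b c d =
     pluecker a b * pluecker c d - pluecker a c * pluecker b d + pluecker a d * pluecker b c"

lemma three_term_signs:
  fixes p q r s t u :: "'a::comm_ring_1"
  shows "- p * q - r * s + t * u = - (p * q - t * u + r * s)"
    and "t * u - p * q + r * - s = - (p * q - t * u + r * s)"
    and "p * - q - t * u + r * s = - (p * q - r * s + t * u)"
  by simp_all

text \<open>The relation is alternating; these three adjacent transpositions generate all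
  permutations of its indices.\<close>

lemma pluecker_relation_swaps:
  assumes "distinct [a, b, c, d]"
  shows "pluecker_relation b a c d = - pluecker_relation a b c d"
    and "pluecker_relation a c b d = - pluecker_relation a b c d"
    and "pluecker_relation a b d c = - pluecker_relation a b c d"
proof -
  have sw: "pluecker b a = - pluecker a b" "pluecker c b = - pluecker b c" "pluecker d c = - pluecker c d"
    using assms pluecker_swap[of a b] pluecker_swap[of b c] pluecker_swap[of c d] by auto
  show "pluecker_relation b a c d = - pluecker_relation a b c d"
    unfolding pluecker_relation_def sw mult.commute[of "pluecker b d"] mult.commute[of "pluecker b c"]
    by (rule three_term_signs(1))
  show "pluecker_relation a c b d = - pluecker_relation a b c d"
    unfolding pluecker_relation_def sw by (rule three_term_signs(2))
  show "pluecker_relation a b d c = - pluecker_relation a b c d"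
    unfolding pluecker_relation_def sw by (rule three_term_signs(3))
qed

lemma grassmannian_generator_carrier:
  assumes "1 \<le> i" "i < j" "j < k" "k < l" "l \<le> n"
  shows "Var (i, j) * Var (k, l) - Var (i, k) * Var (j, l) + Var (i, l) * Var (j, k)
    \<in> carrier (poly_ring (sigma_vars {1..n}))"
  using assms
  by (intro carrier_add carrier_diff carrier_mult carrier_Var) (auto simp: sigma_vars_def)

lemma grassmannian_ideal_ideal: "ideal (grassmannian_ideal n) (poly_ring (sigma_vars {1..n}))"
  unfolding grassmannian_ideal_def
  by (rule ring.genideal_ideal[OF cring.axioms(1)[OF poly_ring_cring]])
    (use grassmannian_generator_carrier in blast)

lemma pluecker_relation_sorted:
  assumes "a < b" "b < c" "c < d" "1 \<le> a" "d \<le> n"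
  shows "pluecker_relation a b c d \<in> grassmannian_ideal n"
proof -
  have sub: "{Var (i, j) * Var (k, l) - Var (i, k) * Var (j, l) + Var (i, l) * Var (j, k) | i j k l.
        1 \<le> i \<and> i < j \<and> j < k \<and> k < l \<and> l \<le> n} \<subseteq> carrier (poly_ring (sigma_vars {1..n}))"
    using grassmannian_generator_carrier by blast
  have "pluecker_relation a b c d =
      Var (a, b) * Var (c, d) - Var (a, c) * Var (b, d) + Var (a, d) * Var (b, c)"
    using assms by (simp add: pluecker_relation_def pluecker_less)
  then show ?thesis
    unfolding grassmannian_ideal_def using assms
    by (intro subsetD[OF ring.genideal_self[OF cring.axioms(1)[OF poly_ring_cring] sub]]) blast
qed

text \<open>Insertion sort of the indices by adjacent transpositions, each of which only changes the
  sign.\<close>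

lemma pluecker_relation_in_grassmannian_ideal:
  assumes "{a, b, c, d} \<subseteq> {1..n}" "distinct [a, b, c, d]"
  shows "pluecker_relation a b c d \<in> grassmannian_ideal n"
proof -
  \<comment> \<open>The hypotheses are premises inside \<open>R\<close>, so cases with repeated
    indices hold vacuously.\<close>
  define R where "R a b c d \<longleftrightarrow> {a, b, c, d} \<subseteq> {1..n} \<longrightarrow> distinct [a, b, c, d] \<longrightarrow>
    pluecker_relation a b c d \<in> grassmannian_ideal n" for a b c d
  note neg = ideal_poly_ring_uminus[OF grassmannian_ideal_ideal]
  have s1: "R b a c d" and s2: "R a c b d" and s3: "R a b d c" if "R a b c d" for a b c d
    using that neg pluecker_relation_swaps[of a b c d] by (auto simp: R_def)
  have base: "R a b c d" if "a < b" "b < c" "c < d" for a b c d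
    using that pluecker_relation_sorted[of a b c d n] by (auto simp: R_def)
  \<comment> \<open>Here \<open>d\<close> is inserted into the sorted \<open>a\<close>,
    \<open>b\<close>, \<open>c\<close>; next \<open>c\<close> into the sorted \<open>a\<close>,
    \<open>b\<close>; finally \<open>a\<close> and \<open>b\<close> are put in order.\<close>
  have R3: "R a b c d" if "a < b" "b < c" for a b c d
  proof -
    consider "c < d" | "b < d" "d < c" | "a < d" "d < b" | "d < a" | "d \<in> {a, b, c}"
      by fastforce
    then show ?thesis
    proof cases
      case 1 with that show ?thesis by (intro base)
    next
      case 2 with that show ?thesis by (intro s3[OF base])
    next
      case 3 with that show ?thesis by (intro s3[OF s2[OF base]])
    next
      case 4 with that show ?thesis by (intro s3[OF s2[OF s1[OF base]]])
    next
      case 5 then show ?thesis by (auto simp: R_def)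
    qed
  qed
  have R2: "R a b c d" if "a < b" for a b c d
  proof -
    consider "b < c" | "a < c" "c < b" | "c < a" | "c \<in> {a, b}" by fastforce
    then show ?thesis
    proof cases
      case 1 with that show ?thesis by (intro R3)
    next
      case 2 with that show ?thesis by (intro s2[OF R3])
    next
      case 3 with that show ?thesis by (intro s2[OF s1[OF R3]])
    next
      case 4 then show ?thesis by (auto simp: R_def)
    qed
  qed
  have "R a b c d"
    using R2[of a b c d] s1[OF R2[of b a c d]] assms(2) by (cases a b rule: linorder_cases) auto
  with assms show ?thesis by (simp add: R_def)
qed

text \<open>Up to sign, \<open>ti * tj * (xi - xj)\<close> is the minor formed by the columns
  \<open>(ti, ti * xi)\<close> and \<open>(tj, tj * xj)\<close> of a matrix with two rows.\<close>

lemma expansion_pluecker_zero: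
  fixes ti tj tk tl xi xj xk xl :: "'a::comm_ring_1"
  shows "ti * tj * (xi - xj) * (tk * tl * (xk - xl)) - ti * tk * (xi - xk) * (tj * tl * (xj - xl))
    + ti * tl * (xi - xl) * (tj * tk * (xj - xk)) = 0"
  by (simp add: algebra_simps)

text \<open>
  The vertex \<open>L i j\<close> is the lowest common ancestor of the leaves \<open>i\<close> and \<open>j\<close>, \<open>W v\<close> is the number
  of vertices below \<open>v\<close>, and \<open>S v i\<close> says that \<open>i\<close> is below the first child of \<open>v\<close>.
\<close>

locale leaf_joins =
  fixes n :: nat and N :: "'v set" and L :: "nat \<Rightarrow> nat \<Rightarrow> 'v"
    and W :: "'v \<Rightarrow> real" and S :: "'v \<Rightarrow> nat \<Rightarrow> bool"
  assumes finite_N: "finite N"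
    and L_in_N: "\<lbrakk>i \<in> {1..n}; j \<in> {1..n}\<rbrakk> \<Longrightarrow> L i j \<in> N"
    and L_commute: "L i j = L j i"
    and L_diag: "\<lbrakk>i \<in> {1..n}; j \<in> {1..n}; k \<in> {1..n}; L i i = L j k\<rbrakk> \<Longrightarrow> j = i \<and> k = i"
    and W_diag: "\<lbrakk>i \<in> {1..n}; j \<in> {1..n}; i \<noteq> j\<rbrakk> \<Longrightarrow> W (L i i) < W (L i j)"
    and ultrametric: "\<lbrakk>i \<in> {1..n}; j \<in> {1..n}; k \<in> {1..n}; i \<noteq> j; i \<noteq> k; j \<noteq> k\<rbrakk> \<Longrightarrow>
        L i j = L i k \<and> W (L j k) < W (L i j) \<or> L i j = L j k \<and> W (L i k) < W (L i j) \<or>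
        L i k = L j k \<and> W (L i j) < W (L i k)"
    and W_le: "\<lbrakk>i \<in> {1..n}; j \<in> {1..n}; k \<in> {1..n}; l \<in> {1..n}; L i j = L k l\<rbrakk> \<Longrightarrow>
        W (L i k) \<le> W (L i j)"
    and S_separates: "\<lbrakk>i \<in> {1..n}; j \<in> {1..n}; i \<noteq> j\<rbrakk> \<Longrightarrow> S (L i j) i \<noteq> S (L i j) j"
    and S_lower: "\<lbrakk>i \<in> {1..n}; j \<in> {1..n}; S v i \<noteq> S v j; v \<noteq> L i j\<rbrakk> \<Longrightarrow> W v < W (L i j)"
begin

abbreviation X where "X \<equiv> sigma_vars {1..n}"

section \<open>Degeneration of a parametrisation by minors\<close>

definition weight :: "nat \<times> nat \<Rightarrow> real" where
  "weight = (\<lambda>(i, j). W (L i j))"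

text \<open>The leading coefficient of \<open>coord i - coord j\<close>, and 1 on the diagonal,
  where no difference is taken.\<close>

definition join_sign :: "nat \<times> nat \<Rightarrow> complex" where
  "join_sign = (\<lambda>(i, j). if i = j \<or> S (L i j) i then 1 else -1)"

text \<open>\<open>Inl i\<close> stands for \<open>t_i\<close> and \<open>Inr v\<close> for
  \<open>a_v\<close>.\<close>

definition join_mon :: "nat \<times> nat \<Rightarrow> (nat + 'v) \<Rightarrow>\<^sub>0 nat" where
  "join_mon = (\<lambda>(i, j). Poly_Mapping.single (Inl i) 1 + Poly_Mapping.single (Inl j) 1 +
     Poly_Mapping.single (Inr (L i j)) 1)"

definition signed_join :: "nat \<times> nat \<Rightarrow> (nat + 'v) mpoly" where
  "signed_join p = Poly_Mapping.single (join_mon p) (join_sign p)"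

definition coord :: "nat \<Rightarrow> (nat + 'v) mpoly" where
  "coord i = (\<Sum>v\<in>N. Const (if S v i then 1 else 0) * Var (Inr v))"

text \<open>Off the diagonal these are 2 by 2 minors. The diagonal variables are not constrained by
  the Pluecker relations and get monomials that already equal their leading parts.\<close>

definition minor :: "nat \<times> nat \<Rightarrow> (nat + 'v) mpoly" where
  "minor = (\<lambda>(i, j). Var (Inl i) * Var (Inl j) *
     (if i = j then Var (Inr (L i j)) else coord i - coord j))"

definition var_weight :: "nat + 'v \<Rightarrow> real" where
  "var_weight = case_sum (\<lambda>_. 0) W"

definition initial :: "(nat \<times> nat) mpoly set" where
  "initial = initial_ideal X weight (grassmannian_ideal n)"

lemma join_sign_cases: "join_sign p \<in> {1, -1}"
  by (cases p) (simp add: join_sign_def)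

lemma join_mon_edge: "join_mon (edge i j) = Poly_Mapping.single (Inl i) 1 + Poly_Mapping.single (Inl j) 1 +
     Poly_Mapping.single (Inr (L i j)) 1"
  by (simp add: edge_def join_mon_def L_commute[of j i] ac_simps)

lemma weight_edge: "weight (edge i j) = W (L i j)"
  by (simp add: edge_def weight_def L_commute[of j i])

lemma expo_edge_mon: "expo join_mon (edge_mon i j) = join_mon (edge i j)"
  by (simp add: edge_mon_def)

lemma leading_single: "leading \<omega> (monom_weight \<omega> m) (Poly_Mapping.single m c) (Poly_Mapping.single m c)"
  by (simp add: leading_def)

lemma leading_Var: "leading \<omega> (\<omega> x) (Var x) (Var x)"
  by (simp add: leading_def Var_def)

text \<open>Only vertices that separate \<open>i\<close> from \<open>j\<close> survive in
  \<open>coord i - coord j\<close>, and by \<open>S_lower\<close> all of them except the join are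
  lighter than the join.\<close>

lemma leading_minor:
  assumes "p \<in> X"
  shows "leading var_weight (weight p) (minor p) (signed_join p)"
proof -
  obtain i j where p: "p = (i, j)" "i \<in> {1..n}" "j \<in> {1..n}"
    using assms by (auto simp: sigma_vars_def)
  let ?c = "Const (join_sign p) * Var (Inr (L i j)) :: (nat + 'v) mpoly"
  have t: "leading var_weight 0 (Var (Inl k)) (Var (Inl k))" for k
    using leading_Var[of var_weight "Inl k"] by (simp add: var_weight_def)
  have v: "leading var_weight (W v) (Var (Inr v)) (Var (Inr v))" for v
    using leading_Var[of var_weight "Inr v"] by (simp add: var_weight_def)
  have "leading var_weight (W (L i j)) (if i = j then Var (Inr (L i j)) else coord i - coord j) ?c"
  proof (cases "i = j")
    case True
    with v p show ?thesis by (simp add: join_sign_def)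
  next
    case False
    \<comment> \<open>The coefficients of the difference lie in \<open>{0, 1, -1}\<close>; the one
      at the join is nonzero by \<open>S_separates\<close>.\<close>
    define c where "c v = (if S v i then 1 else 0) - (if S v j then 1 else 0 :: complex)" for v
    have "coord i - coord j = (\<Sum>v\<in>N. Const (c v) * Var (Inr v))"
      by (simp add: coord_def c_def sum_subtractf[symmetric] left_diff_distrib[symmetric] Const_def
          single_diff)
    moreover have "leading var_weight (W (L i j)) (Const (c v) * Var (Inr v))
        (if v = L i j then ?c else 0)" for v
    proof (cases "v = L i j")
      case True
      have "c v = join_sign p"
        using S_separates[OF p(2,3) False] False p(1) True by (auto simp: c_def join_sign_def)
      with True v[of v] show ?thesis by (simp add: leading_Const_mult)
    next
      case neq: False
      show ?thesis
      proof (cases "S v i = S v j")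
        case True
        then show ?thesis using neq by (simp add: c_def)
      next
        case False
        with p neq have "W v < W (L i j)" by (intro S_lower) auto
        from leading_low[OF leading_Const_mult[OF v] this] neq show ?thesis by simp
      qed
    qed
    then have "leading var_weight (W (L i j)) (\<Sum>v\<in>N. Const (c v) * Var (Inr v))
        (\<Sum>v\<in>N. if v = L i j then ?c else 0)"
      by (intro leading_sum)
    ultimately show ?thesis
      using False finite_N L_in_N[OF p(2,3)] by simp
  qed
  from leading_mult[OF leading_mult[OF t t] this, of i j]
  have "leading var_weight (W (L i j)) (minor p) (Var (Inl i) * Var (Inl j) * ?c)"
    by (simp add: minor_def p)
  moreover have "Var (Inl i) * Var (Inl j) * ?c = signed_join p"
    by (simp add: signed_join_def p join_mon_def Var_def mult_single)
  ultimately show ?thesis by (simp add: weight_def p)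
qed

lemma grassmannian_ideal_subset_kernel:
  "grassmannian_ideal n \<subseteq> {f \<in> carrier (poly_ring X). subst_hom minor f = 0}"
  unfolding grassmannian_ideal_def
proof (rule ring.genideal_minimal[OF cring.axioms(1)[OF poly_ring_cring] subst_hom_kernel_ideal], safe)
  fix i j k l assume *: "1 \<le> i" "i < j" "j < k" "k < l" "l \<le> n"
  then show "Var (i, j) * Var (k, l) - Var (i, k) * Var (j, l) + Var (i, l) * Var (j, k)
      \<in> carrier (poly_ring X)"
    by (rule grassmannian_generator_carrier)
  show "subst_hom minor (Var (i, j) * Var (k, l) - Var (i, k) * Var (j, l) + Var (i, l) * Var (j, k)) = 0"
    using * expansion_pluecker_zero[of "Var (Inl i)" "Var (Inl j)" "coord i" "coord j" "Var (Inl k)"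
        "Var (Inl l)" "coord k" "coord l"]
    by (simp add: subst_hom_add subst_hom_diff subst_hom_mult minor_def)
qed

lemma grassmannian_carrier: "f \<in> grassmannian_ideal n \<Longrightarrow> f \<in> carrier (poly_ring X)"
  using grassmannian_ideal_subset_kernel by blast

lemma initial_forms_carrier:
  "initial_form weight ` grassmannian_ideal n \<subseteq> carrier (poly_ring X)"
  using carrier_initial_form grassmannian_carrier by blast

lemma initial_ideal_ideal: "ideal initial (poly_ring X)"
  unfolding initial_def initial_ideal_def
  by (rule ring.genideal_ideal[OF cring.axioms(1)[OF poly_ring_cring] initial_forms_carrier])

lemma initial_subset_kernel:
  "initial \<subseteq> {f \<in> carrier (poly_ring X). subst_hom signed_join f = 0}"
  unfolding initial_def initial_ideal_def
proof (rule ring.genideal_minimal[OF cring.axioms(1)[OF poly_ring_cring] subst_hom_kernel_ideal], safe)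
  fix f assume f: "f \<in> grassmannian_ideal n"
  then show "initial_form weight f \<in> carrier (poly_ring X)"
    using initial_forms_carrier by blast
  from f have "f \<in> carrier (poly_ring X)" "subst_hom minor f = 0"
    using grassmannian_ideal_subset_kernel by auto
  then show "subst_hom signed_join (initial_form weight f) = 0"
    using leading_minor
    by (intro subst_hom_initial_form_eq_0[where X = X and u = var_weight and s = minor]) auto
qed

lemma initial_formI: "f \<in> grassmannian_ideal n \<Longrightarrow> initial_form weight f \<in> initial"
  unfolding initial_def initial_ideal_def
  by (intro subsetD[OF ring.genideal_self[OF cring.axioms(1)[OF poly_ring_cring] initial_forms_carrier]]) blast

section \<open>Congruence of monomials modulo the initial ideal\<close>

text \<open>Each monomial carries its own sign as coefficient, so that \<open>signed_join\<close>
  sends both terms to monomials with coefficient 1. The relation is thereby compatible with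
  products, with no further signs to track.\<close>

definition mon_equiv :: "(nat \<times> nat \<Rightarrow>\<^sub>0 nat) \<Rightarrow> (nat \<times> nat \<Rightarrow>\<^sub>0 nat) \<Rightarrow> bool" where
  "mon_equiv m m' \<longleftrightarrow> Poly_Mapping.single m (monomial_eval join_sign m) -
     Poly_Mapping.single m' (monomial_eval join_sign m') \<in> initial"

lemma mon_equiv_refl [simp]: "mon_equiv m m"
  by (simp add: mon_equiv_def ideal_poly_ring_0[OF initial_ideal_ideal])

lemma mon_equiv_trans:
  assumes "mon_equiv m m'" "mon_equiv m' m''"
  shows "mon_equiv m m''"
  using ideal_poly_ring_add[OF initial_ideal_ideal, OF assms[unfolded mon_equiv_def]]
  by (simp add: mon_equiv_def)

lemma mon_equiv_sym:
  assumes "mon_equiv m m'"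
  shows "mon_equiv m' m"
  using ideal_poly_ring_uminus[OF initial_ideal_ideal, OF assms[unfolded mon_equiv_def]]
  by (simp add: mon_equiv_def)

lemma mon_equiv_add:
  assumes "mon_equiv m m'" "Poly_Mapping.keys m0 \<subseteq> X"
  shows "mon_equiv (m + m0) (m' + m0)"
  using ideal_poly_ring_mult[OF initial_ideal_ideal, OF assms(1)[unfolded mon_equiv_def] carrier_single[OF assms(2), of "monomial_eval join_sign m0"]]
  by (simp add: mon_equiv_def right_diff_distrib mult_single monomial_eval_add ac_simps)

text \<open>By \<open>L\<close> two terms of the Pluecker relation are equally heavy, and by
  \<open>low\<close> the third is lighter, so the initial form is a binomial.\<close>

lemma swap_mon_equiv:
  assumes V: "{a, b, c, d} \<subseteq> {1..n}" and dist: "distinct [a, b, c, d]"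
    and L: "L a b = L a c" "L c d = L b d"
    and low: "W (L a d) + W (L b c) < W (L a b) + W (L c d)"
  shows "mon_equiv (edge_mon a b + edge_mon c d) (edge_mon a c + edge_mon b d)"
proof -
  let ?m1 = "edge_mon a b + edge_mon c d" and ?m2 = "edge_mon a c + edge_mon b d"
    and ?m3 = "edge_mon a d + edge_mon b c"
  let ?s1 = "edge_sign a b * edge_sign c d" and ?s2 = "edge_sign a c * edge_sign b d"
    and ?s3 = "edge_sign a d * edge_sign b c"
  let ?g = "Poly_Mapping.single ?m1 ?s1 + Poly_Mapping.single ?m2 (- ?s2)"
  have wt: "monom_weight weight (edge_mon i j + edge_mon k l) = W (L i j) + W (L k l)" for i j k l
    by (simp add: monom_weight_add edge_mon_def weight_edge)
  have rel: "pluecker_relation a b c d = ?g + Poly_Mapping.single ?m3 ?s3"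
    by (simp add: pluecker_relation_def pluecker_def mult_single single_uminus)
  have "leading weight (W (L a b) + W (L c d)) (?g + Poly_Mapping.single ?m3 ?s3) (?g + 0)"
  proof (intro leading_add)
    show "leading weight (W (L a b) + W (L c d)) (Poly_Mapping.single ?m1 ?s1) (Poly_Mapping.single ?m1 ?s1)"
      using leading_single[of weight ?m1 ?s1] wt by simp
    show "leading weight (W (L a b) + W (L c d)) (Poly_Mapping.single ?m2 (- ?s2)) (Poly_Mapping.single ?m2 (- ?s2))"
      using leading_single[of weight ?m2 "- ?s2"] wt L by simp
    show "leading weight (W (L a b) + W (L c d)) (Poly_Mapping.single ?m3 ?s3) 0"
      using leading_low[OF leading_single[of weight ?m3 ?s3]] wt low by simp
  qed
  then have lead: "leading weight (W (L a b) + W (L c d)) (pluecker_relation a b c d) ?g"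
    by (simp add: rel)
  \<comment> \<open>The variable \<open>edge a b\<close> occurs in the first monomial only, so the
    two terms of \<open>?g\<close> cannot merge.\<close>
  have "Poly_Mapping.lookup ?m1 (edge a b) \<noteq> Poly_Mapping.lookup ?m2 (edge a b)"
  proof -
    have "edge a b \<in> Poly_Mapping.keys ?m1" "edge a b \<notin> Poly_Mapping.keys ?m2"
      using dist by (auto simp: keys_add_nat edge_eq_iff)
    then show ?thesis by (simp add: in_keys_iff)
  qed
  then have neq: "?m1 \<noteq> ?m2" by auto
  have s1: "?s1 * ?s1 = 1"
    by (auto simp: edge_sign_def)
  have "Poly_Mapping.lookup ?g ?m1 = ?s1"
    using neq by (simp add: lookup_add lookup_single when_def)
  moreover have "?s1 \<noteq> 0" using s1 by auto
  ultimately have "?g \<noteq> 0" by (metis lookup_zero)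
  with lead have "initial_form weight (pluecker_relation a b c d) = ?g"
    by (rule initial_form_eqI)
  with initial_formI[OF pluecker_relation_in_grassmannian_ideal[OF V dist]]
  have g: "?g \<in> initial" by simp
  have expo: "expo join_mon ?m1 = expo join_mon ?m2"
    by (simp add: expo_add expo_edge_mon join_mon_edge L ac_simps)
  \<comment> \<open>No case distinction on signs: the binomial is in the kernel of
    \<open>signed_join\<close> and its two monomials have the same image exponent, so their images
    must cancel.\<close>
  have "subst_hom signed_join ?g = 0"
    using g initial_subset_kernel by blast
  then have "Poly_Mapping.single (expo join_mon ?m1) (?s1 * monomial_eval join_sign ?m1 - ?s2 * monomial_eval join_sign ?m2) = 0"
    by (simp add: subst_hom_diff subst_hom_single signed_join_def[abs_def] monomial_eval_term expo
        single_diff single_uminus)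
  then have signs: "?s1 * monomial_eval join_sign ?m1 = ?s2 * monomial_eval join_sign ?m2"
    by (simp only: single_eq_0_iff right_minus_eq)
  \<comment> \<open>Multiplication by this constant turns the coefficients of \<open>?g\<close> into
    the ones required by \<open>mon_equiv\<close>, because signs square to 1.\<close>
  define \<kappa> where "\<kappa> = ?s1 * monomial_eval join_sign ?m1"
  have invol: "(s * x) * s = x" if "s * s = 1" for s x :: complex
    using that by (metis mult.assoc mult.commute mult_1)
  have k1: "\<kappa> * ?s1 = monomial_eval join_sign ?m1"
    unfolding \<kappa>_def by (rule invol[OF s1])
  have s2: "?s2 * ?s2 = 1"
    by (auto simp: edge_sign_def)
  have k2: "\<kappa> * ?s2 = monomial_eval join_sign ?m2"
    unfolding \<kappa>_def signs by (rule invol[OF s2])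
  have "Const \<kappa> * ?g \<in> initial"
    unfolding Const_def
    by (rule ideal_poly_ring_mult[OF initial_ideal_ideal g carrier_single]) simp
  also have "Const \<kappa> * ?g = Poly_Mapping.single ?m1 (\<kappa> * ?s1) - Poly_Mapping.single ?m2 (\<kappa> * ?s2)"
    unfolding distrib_left Const_mult_single by (simp add: single_uminus)
  finally show ?thesis
    unfolding mon_equiv_def k1 k2 .
qed

lemma exists_keys_of_expo:
  assumes "y \<in> Poly_Mapping.keys (expo join_mon m)"
  shows "\<exists>p\<in>Poly_Mapping.keys m. y \<in> Poly_Mapping.keys (join_mon p)"
  using assms by (simp add: keys_expo)

lemma keys_join_mon:
  "Poly_Mapping.keys (join_mon (i, j)) = {Inl i, Inl j, Inr (L i j)}"
  by (auto simp: join_mon_def keys_add_nat)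

lemma edge_of_expo_leaf:
  assumes "Inl i \<in> Poly_Mapping.keys (expo join_mon m)" "Poly_Mapping.keys m \<subseteq> X"
  obtains x where "edge i x \<in> Poly_Mapping.keys m"
proof -
  from exists_keys_of_expo[OF assms(1)] obtain a b where "(a, b) \<in> Poly_Mapping.keys m" "i = a \<or> i = b"
    by (auto simp: keys_join_mon)
  moreover from this assms(2) have "(a, b) = edge a b"
    by (auto simp: sigma_vars_def edge_def)
  ultimately show ?thesis
    using that[of a] that[of b] by (auto simp: edge_commute[of b a])
qed

text \<open>One Pluecker binomial moves \<open>l\<close> from \<open>k\<close> to a leaf \<open>i\<close> on the same side of \<open>v\<close>.\<close>

lemma exchange_step:
  assumes m: "Poly_Mapping.keys m \<subseteq> X" "edge k l \<in> Poly_Mapping.keys m"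
    and min: "\<And>u. Inr u \<in> Poly_Mapping.keys (expo join_mon m) \<Longrightarrow> W (L i j) \<le> W u"
    and ij: "i \<in> {1..n}" "j \<in> {1..n}" "i \<noteq> j" "L k l = L i j"
    and S: "S (L i j) k = S (L i j) i" "S (L i j) l \<noteq> S (L i j) i"
    and i: "Inl i \<in> Poly_Mapping.keys (expo join_mon m)"
  shows "\<exists>m'. mon_equiv m m' \<and> Poly_Mapping.keys m' \<subseteq> X \<and> expo join_mon m' = expo join_mon m \<and>
    edge i l \<in> Poly_Mapping.keys m' \<and> L i l = L i j"
proof (cases "k = i")
  case True
  with m ij show ?thesis by (intro exI[of _ m]) auto
next
  case False
  have kl: "k \<in> {1..n}" "l \<in> {1..n}"
    using m edge_in_sigma_vars[of k l "{1..n}"] by auto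
  have "l \<noteq> i" "k \<noteq> l" using S by auto
  \<comment> \<open>The leaves \<open>i\<close> and \<open>k\<close> are on the same side of the
    join \<open>L i j\<close>, so their own join is another vertex and strictly lighter. The
    ultrametric property then makes \<open>l\<close> meet \<open>i\<close> where it meets
    \<open>k\<close>.\<close>
  have "L i k \<noteq> L i j"
    using S_separates[of i k] ij kl False S by auto
  moreover have "W (L i k) \<le> W (L i j)"
    using W_le[of i j k l] ij kl by simp
  moreover have "L i k = L i l \<and> W (L k l) < W (L i k) \<or> L i k = L k l \<and> W (L i l) < W (L i k) \<or>
      L i l = L k l \<and> W (L i k) < W (L i l)"
    using ultrametric[of i k l] ij kl False \<open>l \<noteq> i\<close> \<open>k \<noteq> l\<close> by auto
  ultimately have il: "L i l = L i j" and ik: "W (L i k) < W (L i j)"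
    using ij(4) by auto
  \<comment> \<open>The exponent of \<open>t_i\<close> in the image is positive, so some variable of
    \<open>m\<close> involves \<open>i\<close>; minimality makes its join at least as heavy as
    \<open>L i j\<close>.\<close>
  obtain x where x: "edge i x \<in> Poly_Mapping.keys m"
    using edge_of_expo_leaf[OF i m(1)] .
  then have xn: "x \<in> {1..n}" using m edge_in_sigma_vars[of i x "{1..n}"] by auto
  show ?thesis
  proof (cases "x = l")
    case True
    with m x il show ?thesis by (intro exI[of _ m]) auto
  next
    case xl: False
    have "Inr (L i x) \<in> Poly_Mapping.keys (join_mon (edge i x))"
      by (simp add: join_mon_edge keys_add_nat)
    then have "Inr (L i x) \<in> Poly_Mapping.keys (expo join_mon m)"
      using x by (auto simp: keys_expo)
    from min[OF this] have ix: "W (L i j) \<le> W (L i x)" .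
    with ik have "x \<noteq> k" by auto
    have "x \<noteq> i"
      using ix W_diag[of i j] ij by auto
    \<comment> \<open>Since \<open>L i k\<close> is lighter than \<open>L i x\<close>, the leaves
      \<open>i\<close> and \<open>k\<close> have the same join with \<open>x\<close>.\<close>
    have "L i k = L i x \<and> W (L k x) < W (L i k) \<or> L i k = L k x \<and> W (L i x) < W (L i k) \<or>
        L i x = L k x \<and> W (L i k) < W (L i x)"
      using ultrametric[of i k x] ij kl xn False \<open>x \<noteq> k\<close> \<open>x \<noteq> i\<close> by auto
    with ik ix have kx: "L i x = L k x" by auto
    have "L i l = L i x \<and> W (L l x) < W (L i l) \<or> L i l = L l x \<and> W (L i x) < W (L i l) \<or>
        L i x = L l x \<and> W (L i l) < W (L i x)"
      using ultrametric[of i l x] ij kl xn xl \<open>l \<noteq> i\<close> \<open>x \<noteq> i\<close> by auto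
    with il ix have lx: "W (L l x) \<le> W (L i x)" by auto
    have "edge i x \<noteq> edge k l"
      using False \<open>l \<noteq> i\<close> by (auto simp: edge_eq_iff)
    from m(2) obtain m1 where m1: "m = m1 + edge_mon k l"
      unfolding edge_mon_def by (rule monomial_split)
    with x \<open>edge i x \<noteq> edge k l\<close> have "edge i x \<in> Poly_Mapping.keys m1"
      by (auto simp: keys_add_nat)
    then obtain m0 where "m1 = m0 + edge_mon i x"
      unfolding edge_mon_def by (rule monomial_split)
    with m1 have m0: "m = (edge_mon l k + edge_mon i x) + m0"
      by (simp add: ac_simps edge_mon_commute[of l k])
    define m' where "m' = (edge_mon l i + edge_mon k x) + m0"
    have keys0: "Poly_Mapping.keys m0 \<subseteq> X"
      using m(1) by (auto simp: m0 keys_add_nat)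
    \<comment> \<open>The pairs \<open>l k\<close> and \<open>i x\<close> become \<open>l i\<close>
      and \<open>k x\<close>. The third pairing is lighter: \<open>L k i\<close> lies strictly under
      \<open>L l k\<close> in weight, and \<open>L l x\<close> is no heavier than
      \<open>L i x\<close>.\<close>
    have "mon_equiv (edge_mon l k + edge_mon i x) (edge_mon l i + edge_mon k x)"
    proof (rule swap_mon_equiv)
      show "{l, k, i, x} \<subseteq> {1..n}" using ij kl xn by blast
      show "distinct [l, k, i, x]"
        using False \<open>l \<noteq> i\<close> \<open>k \<noteq> l\<close> \<open>x \<noteq> k\<close> \<open>x \<noteq> i\<close> xl by auto
      show "L l k = L l i" using ij(4) il by (simp add: L_commute)
      show "L i x = L k x" by (rule kx)
      have "W (L l k) = W (L i j)" using ij(4) by (simp add: L_commute[of l k])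
      with lx ik show "W (L l x) + W (L k i) < W (L l k) + W (L i x)"
        by (simp add: L_commute[of k i])
    qed
    then have "mon_equiv m m'"
      unfolding m0 m'_def using keys0 by (rule mon_equiv_add)
    moreover have "Poly_Mapping.keys m' \<subseteq> X"
      using keys0 ij kl xn by (simp add: m'_def keys_add_nat edge_in_sigma_vars)
    moreover have "expo join_mon m' = expo join_mon m"
      using ij(4) il kx
      by (simp add: m'_def m0 expo_add expo_edge_mon join_mon_edge L_commute[of l] ac_simps)
    moreover have "edge i l \<in> Poly_Mapping.keys m'"
      by (simp add: m'_def keys_add_nat edge_commute[of l i])
    ultimately show ?thesis using il by blast
  qed
qed

text \<open>Cancelling a common variable lowers the degree; this is the only use of the induction
  hypothesis in the theorem that follows.\<close>

lemma mon_equiv_common_key: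
  assumes IH: "\<And>q q'. \<lbrakk>total_degree q < total_degree m; Poly_Mapping.keys q \<subseteq> X; Poly_Mapping.keys q' \<subseteq> X;
      expo join_mon q = expo join_mon q'\<rbrakk> \<Longrightarrow> mon_equiv q q'"
    and keys: "Poly_Mapping.keys m \<subseteq> X" "Poly_Mapping.keys m' \<subseteq> X"
    and expo: "expo join_mon m = expo join_mon m'"
    and p: "p \<in> Poly_Mapping.keys m" "p \<in> Poly_Mapping.keys m'"
  shows "mon_equiv m m'"
proof -
  from p(1) obtain q where q: "m = q + Poly_Mapping.single p 1" by (rule monomial_split)
  from p(2) obtain q' where q': "m' = q' + Poly_Mapping.single p 1" by (rule monomial_split)
  have "mon_equiv q q'"
  proof (rule IH)
    show "total_degree q < total_degree m" by (simp add: q total_degree_add)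
    show "Poly_Mapping.keys q \<subseteq> X" "Poly_Mapping.keys q' \<subseteq> X"
      using keys by (auto simp: q q' keys_add_nat)
    show "expo join_mon q = expo join_mon q'"
      using expo by (simp add: q q' expo_add)
  qed
  then show ?thesis
    unfolding q q' using keys p by (intro mon_equiv_add) auto
qed

theorem mon_equiv_of_expo_eq:
  assumes "Poly_Mapping.keys m \<subseteq> X" "Poly_Mapping.keys m' \<subseteq> X"
    and "expo join_mon m = expo join_mon m'"
  shows "mon_equiv m m'"
  using assms
proof (induction "total_degree m" arbitrary: m m' rule: less_induct)
  case less
  note common = mon_equiv_common_key[OF less.hyps]
  show ?case
  proof (cases "m = 0")
    case True
    \<comment> \<open>The image of every variable contains some \<open>t_i\<close>, so only the
      monomial 1 has the image 1.\<close>
    have "Poly_Mapping.keys m' = {}"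
    proof (rule ccontr)
      assume "Poly_Mapping.keys m' \<noteq> {}"
      then obtain i j where "(i, j) \<in> Poly_Mapping.keys m'" by fastforce
      then have "Inl i \<in> Poly_Mapping.keys (expo join_mon m')"
        unfolding keys_expo by (intro UN_I[of "(i, j)"]) (auto simp: keys_join_mon)
      then show False using less.prems(3) True by simp
    qed
    with True show ?thesis by simp
  next
    case False
    then have "Poly_Mapping.keys m \<noteq> {}" by simp
    then obtain p where p: "p \<in> Poly_Mapping.keys m"
      and min: "\<And>q. q \<in> Poly_Mapping.keys m \<Longrightarrow> weight p \<le> weight q"
      using ex_is_arg_min_if_finite[of "Poly_Mapping.keys m" weight]
      by (force simp: is_arg_min_linorder)
    obtain i j where ij: "p = (i, j)" "i \<in> {1..n}" "j \<in> {1..n}" "i \<le> j"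
      using p less.prems(1) by (auto simp: sigma_vars_def)
    have mem: "Inl i \<in> Poly_Mapping.keys (expo join_mon m)" "Inl j \<in> Poly_Mapping.keys (expo join_mon m)"
      "Inr (L i j) \<in> Poly_Mapping.keys (expo join_mon m)"
      using p unfolding keys_expo by (auto simp: ij keys_join_mon intro!: bexI[of _ "(i, j)"])
    have minW: "W (L i j) \<le> W u" if "Inr u \<in> Poly_Mapping.keys (expo join_mon m)" for u
    proof -
      from exists_keys_of_expo[OF that] obtain q where "q \<in> Poly_Mapping.keys m"
        "Inr u \<in> Poly_Mapping.keys (join_mon q)" by blast
      with min[of q] show ?thesis by (cases q) (auto simp: ij weight_def keys_join_mon)
    qed
    \<comment> \<open>The exponents of the join variable agree, so \<open>m'\<close> also has a
      variable with this join.\<close>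
    from mem(3) less.prems(3) have "Inr (L i j) \<in> Poly_Mapping.keys (expo join_mon m')" by simp
    from exists_keys_of_expo[OF this] obtain q where "q \<in> Poly_Mapping.keys m'"
      "Inr (L i j) \<in> Poly_Mapping.keys (join_mon q)" by blast
    then obtain a b where ab: "(a, b) \<in> Poly_Mapping.keys m'" "L a b = L i j"
      by (cases q) (auto simp: keys_join_mon)
    then have abn: "a \<in> {1..n}" "b \<in> {1..n}" "a \<le> b"
      using less.prems(2) by (auto simp: sigma_vars_def)
    show ?thesis
    proof (cases "i = j")
      case True
      \<comment> \<open>A leaf is the join of itself with itself only, so \<open>m'\<close> contains
        the same diagonal variable.\<close>
      with L_diag[of i a b] ab abn ij have "(a, b) = p" by auto
      with ab p common[of m m' p] less.prems show ?thesis by blast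
    next
      case neq: False
      have "a \<noteq> b"
        using L_diag[of a i j] ab abn ij neq by auto
      have Sij: "S (L i j) i \<noteq> S (L i j) j" using S_separates ij neq by blast
      have Sab: "S (L i j) a \<noteq> S (L i j) b" using S_separates[of a b] abn \<open>a \<noteq> b\<close> ab by auto
      \<comment> \<open>The ends of the variable found in \<open>m'\<close> are named so that
        \<open>k\<close> is on the side of \<open>i\<close>.\<close>
      obtain k l where kl: "edge k l \<in> Poly_Mapping.keys m'" "L k l = L i j"
        "S (L i j) k = S (L i j) i" "S (L i j) l \<noteq> S (L i j) i"
      proof (cases "S (L i j) a = S (L i j) i")
        case True
        with that[of a b] ab abn Sab show ?thesis by (auto simp: edge_def)
      next
        case False
        with that[of b a] ab abn Sab \<open>a \<noteq> b\<close> show ?thesis by (auto simp: edge_def L_commute[of b a])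
      qed
      from less.prems(3) mem minW have
        mem': "Inl i \<in> Poly_Mapping.keys (expo join_mon m')" "Inl j \<in> Poly_Mapping.keys (expo join_mon m')"
        and minW': "\<And>u. Inr u \<in> Poly_Mapping.keys (expo join_mon m') \<Longrightarrow> W (L i j) \<le> W u" by auto
      \<comment> \<open>The first exchange produces \<open>i l\<close> from \<open>k l\<close>; the
        second produces \<open>j i\<close> from \<open>l i\<close>, with \<open>i\<close> and
        \<open>j\<close> in exchanged roles. The image does not change, so minimality
        persists.\<close>
      from exchange_step[OF less.prems(2) kl(1) minW' ij(2,3) neq kl(2-4) mem'(1)]
      obtain m1 where m1: "mon_equiv m' m1" "Poly_Mapping.keys m1 \<subseteq> X"
        "expo join_mon m1 = expo join_mon m'" "edge i l \<in> Poly_Mapping.keys m1" "L i l = L i j"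
        by blast
      have Lji: "L j i = L i j" by (rule L_commute)
      have "\<exists>m2. mon_equiv m1 m2 \<and> Poly_Mapping.keys m2 \<subseteq> X \<and> expo join_mon m2 = expo join_mon m1 \<and>
          edge j i \<in> Poly_Mapping.keys m2 \<and> L j i = L j i"
      proof (rule exchange_step[of m1 l i j i])
        show "Poly_Mapping.keys m1 \<subseteq> X" by (rule m1(2))
        show "edge l i \<in> Poly_Mapping.keys m1" using m1(4) by (simp add: edge_commute)
        show "W (L j i) \<le> W u" if "Inr u \<in> Poly_Mapping.keys (expo join_mon m1)" for u
          using that minW' m1(3) by (simp add: Lji)
        show "L l i = L j i" using m1(5) by (simp add: Lji L_commute[of l i])
        show "S (L j i) l = S (L j i) j" "S (L j i) i \<noteq> S (L j i) j"
          using Sij kl(4) by (auto simp: Lji)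
        show "Inl j \<in> Poly_Mapping.keys (expo join_mon m1)" using mem' m1(3) by simp
      qed (use ij neq in auto)
      then obtain m2 where m2: "mon_equiv m1 m2" "Poly_Mapping.keys m2 \<subseteq> X"
        "expo join_mon m2 = expo join_mon m1" "edge j i \<in> Poly_Mapping.keys m2"
        by blast
      have "edge j i = p" using ij by (simp add: edge_def)
      with p m2(4) have "p \<in> Poly_Mapping.keys m2" by simp
      moreover have "expo join_mon m = expo join_mon m2"
        using less.prems(3) m1(3) m2(3) by simp
      ultimately have "mon_equiv m m2"
        using common[of m m2 p] less.prems(1) m2(2) p by blast
      moreover have "mon_equiv m2 m'"
        using m1(1) m2(1) by (blast intro: mon_equiv_trans mon_equiv_sym)
      ultimately show ?thesis by (rule mon_equiv_trans)
    qed
  qed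
qed

text \<open>The signed coefficients sum to zero on each fibre, so no monomial of \<open>f\<close> is
  alone in its fibre. A multiple of a binomial in the initial ideal moves the coefficient of one
  monomial to another and shortens \<open>f\<close>.\<close>

lemma kernel_subset_initial:
  assumes "f \<in> carrier (poly_ring X)" "subst_hom signed_join f = 0"
  shows "f \<in> initial"
  using assms
proof (induction "card (Poly_Mapping.keys f)" arbitrary: f rule: less_induct)
  case less
  show ?case
  proof (cases "f = 0")
    case True
    then show ?thesis using ideal_poly_ring_0[OF initial_ideal_ideal] by simp
  next
    case False
    then obtain m where m: "m \<in> Poly_Mapping.keys f" by fastforce
    let ?c = "Poly_Mapping.lookup f m" and ?s = "monomial_eval join_sign"
    have sq: "?s m * ?s m = 1" for m by (rule monomial_eval_sign[OF join_sign_cases])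
    have "\<exists>m'\<in>Poly_Mapping.keys f. m' \<noteq> m \<and> expo join_mon m' = expo join_mon m"
    proof (rule ccontr)
      assume "\<not> ?thesis"
      with m have "{m'. m' \<in> Poly_Mapping.keys f \<and> expo join_mon m' = expo join_mon m} = {m}" by auto
      with less.prems(2) lookup_subst_hom_term[of join_mon join_sign f "expo join_mon m"]
      have "?c * ?s m = 0" by (simp add: signed_join_def[abs_def])
      with m sq[of m] show False by (auto simp: in_keys_iff)
    qed
    then obtain m' where m': "m' \<in> Poly_Mapping.keys f" "m' \<noteq> m" "expo join_mon m' = expo join_mon m"
      by blast
    define h where "h = Poly_Mapping.single m (?s m) - Poly_Mapping.single m' (?s m')"
    have keys: "Poly_Mapping.keys m \<subseteq> X" "Poly_Mapping.keys m' \<subseteq> X"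
      using less.prems(1) m m' by (auto simp: in_carrier_poly_ring)
    from mon_equiv_of_expo_eq[OF this m'(3)[symmetric]] have h: "h \<in> initial"
      by (simp add: mon_equiv_def h_def)
    \<comment> \<open>The factor makes the term of \<open>g\<close> at \<open>m\<close> equal to
      that of \<open>f\<close>; the other term falls on \<open>m'\<close>, which is already a
      monomial of \<open>f\<close>.\<close>
    define g where "g = Poly_Mapping.single 0 (?c * ?s m) * h"
    have g: "g \<in> initial"
      unfolding g_def by (rule ideal_poly_ring_mult[OF initial_ideal_ideal h carrier_single]) simp
    have g_eq: "g = Poly_Mapping.single m ?c - Poly_Mapping.single m' (?c * ?s m * ?s m')"
      using sq[of m] by (simp add: g_def h_def right_diff_distrib mult_single mult.assoc)
    have "f - g \<in> initial"
    proof (rule less.hyps)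
      have "Poly_Mapping.lookup (f - g) m = 0"
        using m'(2) by (simp add: g_eq lookup_minus lookup_single when_def)
      moreover have "Poly_Mapping.keys (f - g) \<subseteq> Poly_Mapping.keys f"
      proof
        fix q assume "q \<in> Poly_Mapping.keys (f - g)"
        with m m' show "q \<in> Poly_Mapping.keys f"
          by (cases "q = m \<or> q = m'") (auto simp: g_eq in_keys_iff lookup_minus lookup_single when_def)
      qed
      ultimately have "Poly_Mapping.keys (f - g) \<subset> Poly_Mapping.keys f"
        using m by (auto simp: in_keys_iff)
      then show "card (Poly_Mapping.keys (f - g)) < card (Poly_Mapping.keys f)"
        by (intro psubset_card_mono) auto
      from g initial_subset_kernel have "g \<in> carrier (poly_ring X)" "subst_hom signed_join g = 0" by auto
      with less.prems show "f - g \<in> carrier (poly_ring X)" "subst_hom signed_join (f - g) = 0"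
        by (simp_all add: carrier_diff subst_hom_diff)
    qed
    from ideal_poly_ring_add[OF initial_ideal_ideal this g] show ?thesis by simp
  qed
qed

theorem initial_eq_kernel:
  "initial = {f \<in> carrier (poly_ring X). subst_hom signed_join f = 0}"
  using initial_subset_kernel kernel_subset_initial by blast

end

section \<open>Ancestors in rooted trees\<close>

lemma pcas_append: "pcas u (p @ [(a, b)]) w \<longleftrightarrow> pcas u p a \<and> b = w"
  by (induction p arbitrary: u) auto

lemma rtrancl_of_pcas:
  "pcas u p v \<Longrightarrow> set p \<subseteq> E \<Longrightarrow> (u, v) \<in> E\<^sup>*"
proof (induction p arbitrary: u)
  case (Cons e p)
  then show ?case by (cases e) (auto intro: converse_rtrancl_into_rtrancl)
qed simp

lemma vertex_on_arc:
  assumes "w \<in> set p" "p \<noteq> [w]"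
  shows "distinct p \<Longrightarrow> \<exists>u. (w, u) \<in> set (vwalk_arcs p) \<or> (u, w) \<in> set (vwalk_arcs p)"
  using assms
proof (induction p rule: vwalk_arcs.induct)
  case (3 x y xs)
  show ?case
  proof (cases "w = x \<or> w = y")
    case False
    with 3 have "\<exists>u. (w, u) \<in> set (vwalk_arcs (y # xs)) \<or> (u, w) \<in> set (vwalk_arcs (y # xs))"
      by auto
    then show ?thesis by auto
  qed auto
qed auto

locale arborescence =
  fixes G :: "'v pair_pre_digraph" and r :: 'v
  assumes rooted_tree: "rooted_tree G r"
begin

lemma pair_fin: "pair_fin_digraph G"
  using rooted_tree by (simp add: rooted_tree_def)

lemma finite_verts: "finite (pverts G)"
  using pair_fin by (rule pair_fin_digraph.pair_finite_verts)

lemma finite_arcs: "finite (parcs G)"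
  using pair_fin by (rule pair_fin_digraph.pair_finite_arcs)

lemma arc_verts: "(u, v) \<in> parcs G \<Longrightarrow> u \<in> pverts G \<and> v \<in> pverts G"
  using pair_wf_digraph.wellformed'[OF pair_fin_digraph.axioms(1)[OF pair_fin]] by simp

lemma root_walk:
  assumes "v \<in> pverts G"
  shows "\<exists>!p. set p \<subseteq> parcs G \<and> pcas r p v"
proof -
  have "\<exists>!p. pre_digraph.awalk (with_proj G) r p v" "r \<in> pverts G"
    using rooted_tree assms by (auto simp: rooted_tree_def)
  then show ?thesis
    by (simp add: pre_digraph.awalk_def cas_with_proj_eq)
qed

lemma root_in_verts: "r \<in> pverts G"
  using rooted_tree by (simp add: rooted_tree_def)

text \<open>Distinct parents would give two walks from the root to \<open>v\<close>.\<close>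

lemma parent_unique:
  assumes "(u, v) \<in> parcs G" "(u', v) \<in> parcs G"
  shows "u = u'"
proof -
  obtain p where p: "set p \<subseteq> parcs G" "pcas r p u"
    using root_walk[of u] arc_verts[OF assms(1)] by blast
  obtain p' where p': "set p' \<subseteq> parcs G" "pcas r p' u'"
    using root_walk[of u'] arc_verts[OF assms(2)] by blast
  have "set (p @ [(u, v)]) \<subseteq> parcs G \<and> pcas r (p @ [(u, v)]) v"
    "set (p' @ [(u', v)]) \<subseteq> parcs G \<and> pcas r (p' @ [(u', v)]) v"
    using p p' assms by (auto simp: pcas_append)
  then have "p @ [(u, v)] = p' @ [(u', v)]"
    using root_walk[of v] arc_verts[OF assms(1)] by blast
  then show ?thesis by simp
qed

text \<open>An edge into the root would give a nonempty closed walk at the root besides the empty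
  one.\<close>

lemma root_no_parent: "(u, r) \<notin> parcs G"
proof
  assume u: "(u, r) \<in> parcs G"
  obtain p where "set p \<subseteq> parcs G" "pcas r p u"
    using root_walk[of u] arc_verts[OF u] by blast
  with u have "set (p @ [(u, r)]) \<subseteq> parcs G \<and> pcas r (p @ [(u, r)]) r" by (simp add: pcas_append)
  moreover have "set [] \<subseteq> parcs G \<and> pcas r [] r" by simp
  ultimately have "p @ [(u, r)] = []"
    using root_walk[OF root_in_verts] by blast
  then show False by simp
qed

definition anc :: "'v \<Rightarrow> 'v \<Rightarrow> bool" where
  "anc u v \<longleftrightarrow> (u, v) \<in> (parcs G)\<^sup>*"

lemma anc_refl [simp]: "anc v v"
  by (simp add: anc_def)

lemma anc_trans: "anc u v \<Longrightarrow> anc v w \<Longrightarrow> anc u w"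
  unfolding anc_def by (rule rtrancl_trans)

lemma anc_arc: "(u, v) \<in> parcs G \<Longrightarrow> anc u v"
  by (auto simp: anc_def)

lemma anc_child_cases:
  assumes "anc w v" "(u, v) \<in> parcs G"
  shows "w = v \<or> anc w u"
proof -
  from assms(1) have "(w, v) \<in> (parcs G)\<^sup>*" by (simp add: anc_def)
  then show ?thesis
  proof (cases rule: rtranclE)
    case (step y)
    then show ?thesis using parent_unique[OF assms(2)] by (auto simp: anc_def)
  qed simp
qed

lemma root_anc:
  assumes "v \<in> pverts G"
  shows "anc r v"
proof -
  from root_walk[OF assms] obtain p where "set p \<subseteq> parcs G" "pcas r p v" by blast
  with rtrancl_of_pcas show ?thesis unfolding anc_def by metis
qed

text \<open>A cycle enters each of its vertices from the only parent, so it passes through the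
  parent as well. Moving up in this way leads to the root, which no edge enters.\<close>

lemma no_cycle:
  assumes "v \<in> pverts G"
  shows "(v, v) \<notin> (parcs G)\<^sup>+"
proof -
  from root_anc[OF assms] show ?thesis
    unfolding anc_def
  proof (induction rule: rtrancl_induct)
    case base
    show ?case using root_no_parent by (auto dest: tranclD2)
  next
    case (step u w)
    show ?case
    proof
      assume "(w, w) \<in> (parcs G)\<^sup>+"
      then obtain y where y: "(w, y) \<in> (parcs G)\<^sup>*" "(y, w) \<in> parcs G" by (auto dest: tranclD2)
      with step(2) have "y = u" by (auto intro: parent_unique)
      with y step have "(u, u) \<in> (parcs G)\<^sup>+" by (auto intro: rtrancl_into_trancl2)
      with step.IH show False by simp
    qed
  qed
qed

lemma anc_verts: "anc u v \<Longrightarrow> v \<in> pverts G \<Longrightarrow> u \<in> pverts G"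
  unfolding anc_def by (induction rule: converse_rtrancl_induct) (auto dest: arc_verts)

lemma anc_antisym:
  assumes "anc u v" "anc v u" "v \<in> pverts G"
  shows "u = v"
proof (rule ccontr)
  assume "u \<noteq> v"
  with assms have "(v, v) \<in> (parcs G)\<^sup>+"
    unfolding anc_def by (metis rtranclD trancl_trans)
  with no_cycle assms(3) show False by blast
qed

lemma arc_neq: "(u, v) \<in> parcs G \<Longrightarrow> u \<noteq> v"
  using no_cycle[of v] arc_verts[of u v] by auto

lemma not_anc_parent: "(u, v) \<in> parcs G \<Longrightarrow> \<not> anc v u"
  using anc_antisym[of u v] anc_arc arc_verts arc_neq by blast

text \<open>By uniqueness of parents, a proper ancestor of a vertex is an ancestor of its parent, so
  comparability is kept when \<open>a\<close> moves up by one edge.\<close>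

lemma anc_chain:
  assumes "anc a c" "anc b c"
  shows "anc a b \<or> anc b a"
  using assms(1) unfolding anc_def[of a c]
proof (induction rule: converse_rtrancl_induct)
  case base
  with assms(2) show ?case by simp
next
  case (step y z)
  then show ?case
    using anc_arc[of y z] anc_child_cases[of b z y] anc_trans[of y z b] by auto
qed

lemma child_towards:
  assumes "anc v i" "v \<noteq> i"
  obtains c where "(v, c) \<in> parcs G" "anc c i"
  using assms unfolding anc_def by (auto elim: converse_rtranclE)

text \<open>An ancestor of the head is the head itself or an ancestor of the tail, so crossing an
  edge changes the set of ancestors by one vertex.\<close>

lemma cut_arc:
  assumes "(a, b) \<in> parcs G" "anc v a \<noteq> anc v b"
  shows "v = b"
  using assms anc_child_cases anc_trans anc_arc by blast

section \<open>Lowest common ancestors and the number of vertices below\<close>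

definition size_below :: "'v \<Rightarrow> real" where
  "size_below v = real (card {w \<in> pverts G. anc v w})"

lemma size_below_less:
  assumes "anc v w" "v \<noteq> w" "w \<in> pverts G"
  shows "size_below w < size_below v"
proof -
  have "{x \<in> pverts G. anc w x} \<subset> {x \<in> pverts G. anc v x}"
  proof
    show "{x \<in> pverts G. anc w x} \<subseteq> {x \<in> pverts G. anc v x}"
      using assms(1) anc_trans by blast
    have "v \<in> {x \<in> pverts G. anc v x}" "v \<notin> {x \<in> pverts G. anc w x}"
      using assms anc_verts anc_antisym by auto
    then show "{x \<in> pverts G. anc w x} \<noteq> {x \<in> pverts G. anc v x}" by blast
  qed
  then show ?thesis
    unfolding size_below_def using finite_verts by (simp add: psubset_card_mono)
qed

lemma size_below_le:
  assumes "anc v w" "w \<in> pverts G"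
  shows "size_below w \<le> size_below v"
  using size_below_less[OF assms(1) _ assms(2)] by (cases "v = w") auto

definition lca :: "'v \<Rightarrow> 'v \<Rightarrow> 'v" where
  "lca i j = (SOME v. anc v i \<and> anc v j \<and> (\<forall>w. anc w i \<and> anc w j \<longrightarrow> anc w v))"

lemma lca_commute: "lca i j = lca j i"
  unfolding lca_def by (rule arg_cong[where f = Eps]) auto

text \<open>Common ancestors are pairwise comparable, so one with the fewest vertices below it lies
  below all the others.\<close>

lemma lca_props:
  assumes "i \<in> pverts G" "j \<in> pverts G"
  shows "anc (lca i j) i \<and> anc (lca i j) j \<and> (\<forall>w. anc w i \<and> anc w j \<longrightarrow> anc w (lca i j))"
  unfolding lca_def
proof (rule someI_ex)
  let ?C = "{v. anc v i \<and> anc v j}"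
  have "?C \<subseteq> pverts G" using anc_verts assms by blast
  then have "finite ?C" using finite_verts finite_subset by blast
  moreover have "?C \<noteq> {}" using root_anc assms by blast
  ultimately obtain v where v: "v \<in> ?C" "\<And>w. w \<in> ?C \<Longrightarrow> size_below v \<le> size_below w"
    using ex_is_arg_min_if_finite[of ?C size_below] by (force simp: is_arg_min_linorder)
  have "anc w v" if "anc w i" "anc w j" for w
  proof (rule ccontr)
    assume "\<not> anc w v"
    with anc_chain[of w i v] that v(1) have "anc v w" "v \<noteq> w" by auto
    with size_below_less[of v w] that assms anc_verts have "size_below w < size_below v" by blast
    with v(2)[of w] that show False by simp
  qed
  with v(1) show "\<exists>v. anc v i \<and> anc v j \<and> (\<forall>w. anc w i \<and> anc w j \<longrightarrow> anc w v)" by blast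
qed

lemma anc_lca_iff:
  assumes "i \<in> pverts G" "j \<in> pverts G"
  shows "anc w (lca i j) \<longleftrightarrow> anc w i \<and> anc w j"
  using lca_props[OF assms] anc_trans by blast

lemma lca_in_verts: "i \<in> pverts G \<Longrightarrow> j \<in> pverts G \<Longrightarrow> lca i j \<in> pverts G"
  using lca_props anc_verts by blast

lemma lca_eqI:
  assumes "i \<in> pverts G" "j \<in> pverts G" "\<And>w. anc w v \<longleftrightarrow> anc w i \<and> anc w j"
  shows "lca i j = v"
proof -
  have "anc v (lca i j)" "anc (lca i j) v"
    using assms anc_lca_iff[OF assms(1,2)] by (metis anc_refl)+
  moreover have "v \<in> pverts G" using assms anc_verts by (metis anc_refl)
  ultimately show ?thesis using anc_antisym by blast
qed

lemma lca_self [simp]: "i \<in> pverts G \<Longrightarrow> lca i i = i"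
  by (rule lca_eqI) auto

section \<open>Treks in rooted trees\<close>

lemma arcs_mk_symmetric: "parcs (mk_symmetric (with_proj G)) = parcs G \<union> (parcs G)\<inverse>"
  by (auto simp: parcs_mk_symmetric)

lemma vpath_sym_iff:
  "vpath p (with_proj (mk_symmetric (with_proj G))) \<longleftrightarrow>
     set p \<subseteq> pverts G \<and> set (vwalk_arcs p) \<subseteq> parcs G \<union> (parcs G)\<inverse> \<and> p \<noteq> [] \<and> distinct p"
  by (simp add: vpath_def vwalk_def arcs_mk_symmetric)

text \<open>The edges whose deletion separates \<open>i\<close> from \<open>j\<close>. This turns
  out to be the edge set of the trek, described without a path.\<close>

definition cut :: "'v \<Rightarrow> 'v \<Rightarrow> ('v \<times> 'v) set" where
  "cut i j = {(u, v) \<in> parcs G. anc v i \<noteq> anc v j}"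

lemma no_collider: "\<not> has_collider G p"
  using parent_unique by (auto simp: has_collider_def path_edges_def)

text \<open>Each step of a walk changes the set of ancestors by a single vertex. If \<open>v\<close>
  is above only one end, some step has to cross the edge into \<open>v\<close>.\<close>

lemma cut_subset_path_edges:
  assumes "set (vwalk_arcs p) \<subseteq> parcs G \<union> (parcs G)\<inverse>" "p \<noteq> []"
  shows "cut (hd p) (last p) \<subseteq> path_edges G p"
  using assms
proof (induction p rule: vwalk_arcs.induct)
  case (3 x y xs)
  show ?case
  proof
    fix e assume "e \<in> cut (hd (x # y # xs)) (last (x # y # xs))"
    then obtain u v where e: "e = (u, v)" "(u, v) \<in> parcs G" "anc v x \<noteq> anc v (last (y # xs))"
      by (auto simp: cut_def)
    show "e \<in> path_edges G (x # y # xs)"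
    proof (cases "anc v x = anc v y")
      case True
      with e have "e \<in> cut (hd (y # xs)) (last (y # xs))" by (simp add: cut_def)
      with 3 have "e \<in> path_edges G (y # xs)" by auto
      then show ?thesis by (auto simp: path_edges_def)
    next
      case False
      have "(x, y) \<in> parcs G \<or> (y, x) \<in> parcs G" using "3.prems" by auto
      then show ?thesis
      proof
        assume xy: "(x, y) \<in> parcs G"
        with False cut_arc have "v = y" by blast
        with xy e parent_unique[of u v x] show ?thesis by (auto simp: path_edges_def)
      next
        assume yx: "(y, x) \<in> parcs G"
        with False cut_arc[of y x v] have "v = x" by blast
        with yx e parent_unique[of u v y] show ?thesis by (auto simp: path_edges_def)
      qed
    qed
  qed
qed (auto simp: cut_def)

lemma path_edges_verts:
  assumes "(u, v) \<in> path_edges G p"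
  shows "u \<in> set p \<and> v \<in> set p"
proof -
  have "a \<in> set p \<and> b \<in> set p" if "(a, b) \<in> set (vwalk_arcs p)" for a b
    using that by (induction p rule: vwalk_arcs.induct) auto
  with assms show ?thesis by (auto simp: path_edges_def)
qed

text \<open>A simple path crosses each of its edges once, and a single crossing decides that exactly
  one end is below the head of the edge.\<close>

lemma path_edges_eq_cut:
  assumes "set (vwalk_arcs p) \<subseteq> parcs G \<union> (parcs G)\<inverse>" "p \<noteq> []" "distinct p" "set p \<subseteq> pverts G"
  shows "path_edges G p = cut (hd p) (last p)"
proof
  show "cut (hd p) (last p) \<subseteq> path_edges G p"
    using cut_subset_path_edges assms by blast
  show "path_edges G p \<subseteq> cut (hd p) (last p)"
    using assms
  proof (induction p rule: vwalk_arcs.induct)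
    case (3 x y xs)
    let ?l = "last (y # xs)"
    have xy: "(x, y) \<in> parcs G \<or> (y, x) \<in> parcs G" using "3.prems" by auto
    \<comment> \<open>Edges that separate the ends of the tail are on the tail, so none of them
      meets \<open>x\<close>.\<close>
    have sub: "cut y ?l \<subseteq> path_edges G (y # xs)"
      using cut_subset_path_edges[of "y # xs"] "3.prems" by auto
    have xnotin: "x \<notin> set (y # xs)" using "3.prems" by simp
    have "anc v x \<noteq> anc v ?l" if uv: "(u, v) \<in> path_edges G (x # y # xs)" for u v
    proof -
      have arc: "(u, v) \<in> parcs G" using uv by (simp add: path_edges_def)
      consider "(u, v) = (x, y)" | "(u, v) = (y, x)" | "(u, v) \<in> path_edges G (y # xs)"
        using uv by (auto simp: path_edges_def)
      then show ?thesis
      proof cases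
        case 1
        then have "\<not> anc y x" using arc not_anc_parent by auto
        moreover have "anc y ?l"
        proof (rule ccontr)
          assume "\<not> anc y ?l"
          then have "(x, y) \<in> cut y ?l" using 1 arc by (simp add: cut_def)
          with sub path_edges_verts xnotin show False by blast
        qed
        ultimately show ?thesis using 1 by simp
      next
        case 2
        then have "\<not> anc x y" using arc not_anc_parent by auto
        have "\<not> anc x ?l"
        proof
          assume "anc x ?l"
          then have "(y, x) \<in> cut y ?l" using 2 arc \<open>\<not> anc x y\<close> by (simp add: cut_def)
          with sub path_edges_verts xnotin show False by blast
        qed
        then show ?thesis using 2 by simp
      next
        case 3
        then have "anc v y \<noteq> anc v ?l"
          using "3.IH" "3.prems" by (auto simp: cut_def)
        \<comment> \<open>The first step affects only the head of the edge between \<open>x\<close>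
          and \<open>y\<close>, and \<open>(u, v)\<close> is a different edge because the tail
          avoids \<open>x\<close>.\<close>
        moreover have "anc v x = anc v y"
        proof (rule ccontr)
          assume neq: "anc v x \<noteq> anc v y"
          from path_edges_verts[OF 3] xnotin have "u \<noteq> x" "v \<noteq> x" by auto
          from xy show False
          proof
            assume "(x, y) \<in> parcs G"
            with cut_arc[of x y v] neq arc parent_unique[of u v x] \<open>u \<noteq> x\<close> show False by auto
          next
            assume "(y, x) \<in> parcs G"
            with cut_arc[of y x v] neq \<open>v \<noteq> x\<close> show False by auto
          qed
        qed
        ultimately show ?thesis by simp
      qed
    qed
    moreover have "path_edges G (x # y # xs) \<subseteq> parcs G" by (auto simp: path_edges_def)
    ultimately show ?case unfolding cut_def list.sel last_ConsR[OF list.distinct(2)] by blast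
  qed (auto simp: path_edges_def)
qed

lemma trek_iff:
  "p \<in> treks G i j \<longleftrightarrow> set p \<subseteq> pverts G \<and> set (vwalk_arcs p) \<subseteq> parcs G \<union> (parcs G)\<inverse> \<and>
     p \<noteq> [] \<and> distinct p \<and> hd p = i \<and> last p = j"
  by (auto simp: treks_def vpath_sym_iff no_collider)

lemma path_edges_trek: "p \<in> treks G i j \<Longrightarrow> path_edges G p = cut i j"
  using path_edges_eq_cut by (auto simp: trek_iff)

lemma vwalk_arcs_suffix: "set (vwalk_arcs (u # q)) \<subseteq> set (vwalk_arcs (p @ u # q))"
  by (induction p rule: vwalk_arcs.induct) auto

lemma trek_exists:
  assumes "i \<in> pverts G" "j \<in> pverts G"
  shows "\<exists>p. p \<in> treks G i j"
proof -
  let ?E = "parcs G \<union> (parcs G)\<inverse>"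
  have "(i, r) \<in> ((parcs G)\<inverse>)\<^sup>*"
    using root_anc[OF assms(1)] by (auto simp: anc_def rtrancl_converse)
  moreover have "(r, j) \<in> (parcs G)\<^sup>*"
    using root_anc[OF assms(2)] by (simp add: anc_def)
  moreover have "((parcs G)\<inverse>)\<^sup>* \<subseteq> ?E\<^sup>*" "(parcs G)\<^sup>* \<subseteq> ?E\<^sup>*"
    by (auto intro: subsetD[OF rtrancl_mono])
  ultimately have "(i, j) \<in> ?E\<^sup>*" by (meson rtrancl_trans subsetD)
  then show ?thesis
  proof (induction rule: converse_rtrancl_induct)
    case base
    show ?case using assms(2) by (intro exI[of _ "[j]"]) (simp add: trek_iff)
  next
    case (step x y)
    then obtain p where p: "p \<in> treks G y j" by blast
    have x: "x \<in> pverts G" using step(1) arc_verts by auto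
    show ?case
    proof (cases "x \<in> set p")
      case True
      \<comment> \<open>If \<open>x\<close> has been visited already, the path is cut back to that
        visit, which keeps it simple.\<close>
      then obtain a b where "p = a @ x # b" by (meson split_list)
      with p vwalk_arcs_suffix[of x b a] have "x # b \<in> treks G x j"
        by (auto simp: trek_iff)
      then show ?thesis by blast
    next
      case False
      from p obtain q where "p = y # q" by (cases p) (auto simp: trek_iff)
      with p False step(1) x have "x # p \<in> treks G x j" by (auto simp: trek_iff)
      then show ?thesis by blast
    qed
  qed
qed

text \<open>All treks from \<open>i\<close> to \<open>j\<close> have the edge set
  \<open>cut i j\<close>. For distinct \<open>i\<close> and \<open>j\<close> it has one edge at
  \<open>i\<close>: the one to the parent if \<open>i\<close> is not above \<open>j\<close>, and
  otherwise the one to the child above \<open>j\<close>.\<close>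

lemma trek_unique:
  assumes "p \<in> treks G i j" "q \<in> treks G i j"
  shows "p = q"
  using assms
proof (induction p arbitrary: i q)
  case Nil
  then show ?case by (simp add: trek_iff)
next
  case (Cons x p)
  then have x: "x = i" by (simp add: trek_iff)
  obtain q' where q: "q = i # q'" using Cons.prems(2) by (cases q) (auto simp: trek_iff)
  show ?case
  proof (cases "i = j")
    case True
    have "p = []"
      using Cons.prems(1) x True by (cases p rule: rev_cases) (auto simp: trek_iff)
    moreover have "q' = []"
      using Cons.prems(2) q True by (cases q' rule: rev_cases) (auto simp: trek_iff)
    ultimately show ?thesis using x q by simp
  next
    case False
    have ne: "p \<noteq> []" "q' \<noteq> []" using Cons.prems x q False by (auto simp: trek_iff)
    then obtain b p1 c q1 where p1: "p = b # p1" and q1: "q' = c # q1"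
      by (meson neq_Nil_conv)
    have b: "(i, b) \<in> parcs G \<or> (b, i) \<in> parcs G"
      and c: "(i, c) \<in> parcs G \<or> (c, i) \<in> parcs G"
      using Cons.prems x q p1 q1 by (auto simp: trek_iff)
    have cut: "path_edges G (i # b # p1) = cut i j" "path_edges G (i # c # q1) = cut i j"
      using path_edges_trek Cons.prems x q p1 q1 by auto
    have up: "\<not> anc i j" if "(d, i) \<in> cut i j" for d
      using that by (auto simp: cut_def)
    have down: "anc d j" "(i, d) \<in> parcs G" if "(i, d) \<in> cut i j" for d
      using that not_anc_parent by (auto simp: cut_def)
    have "(i, b) \<in> path_edges G (i # b # p1) \<or> (b, i) \<in> path_edges G (i # b # p1)"
      "(i, c) \<in> path_edges G (i # c # q1) \<or> (c, i) \<in> path_edges G (i # c # q1)"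
      using b c by (auto simp: path_edges_def)
    then have "(i, b) \<in> cut i j \<or> (b, i) \<in> cut i j" "(i, c) \<in> cut i j \<or> (c, i) \<in> cut i j"
      unfolding cut by simp_all
    \<comment> \<open>The mixed case is contradictory: a cut edge into \<open>i\<close> says that
      \<open>i\<close> is not above \<open>j\<close>, and one out of \<open>i\<close> says that it
      is.\<close>
    then consider "(b, i) \<in> cut i j" "(c, i) \<in> cut i j" | "(i, b) \<in> cut i j" "(i, c) \<in> cut i j"
      | d e where "(i, d) \<in> cut i j" "(e, i) \<in> cut i j" by blast
    then have "b = c"
    proof cases
      case 1
      then show ?thesis using parent_unique by (auto simp: cut_def)
    next
      case 2
      from anc_chain[OF down(1)[OF 2(1)] down(1)[OF 2(2)]] show ?thesis
        using anc_child_cases[of b c i] anc_child_cases[of c b i] not_anc_parent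
          down(2)[OF 2(1)] down(2)[OF 2(2)] by blast
    next
      case 3
      then show ?thesis using up[of e] down[of d] anc_arc[of i d] anc_trans[of i d j] by blast
    qed
    moreover have "p \<in> treks G b j" "q' \<in> treks G c j"
      using Cons.prems x q p1 q1 by (auto simp: trek_iff)
    ultimately show ?thesis using Cons.IH x q by auto
  qed
qed

lemma treks_singleton:
  assumes "i \<in> pverts G" "j \<in> pverts G"
  obtains p where "treks G i j = {p}"
  using trek_exists[OF assms] trek_unique by (metis empty_iff insertI1 singletonD subsetI subset_antisym)

lemma parent_exists:
  assumes "v \<in> pverts G" "v \<noteq> r"
  obtains u where "(u, v) \<in> parcs G"
  using root_anc[OF assms(1)] assms(2) unfolding anc_def by (auto elim: rtranclE)

text \<open>No cut edge enters \<open>w\<close>, so \<open>w\<close> is above both of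
  \<open>i\<close> and \<open>j\<close> once it is above \<open>i\<close>. The step from
  \<open>w\<close> to \<open>v\<close> loses \<open>j\<close>, so no common ancestor is lower than
  \<open>w\<close>.\<close>

lemma lca_of_cut_start:
  assumes ij: "i \<in> pverts G" "j \<in> pverts G"
    and arc: "(w, v) \<in> parcs G" and v: "anc v i" "\<not> anc v j"
    and w: "\<And>u. (u, w) \<notin> cut i j"
  shows "w = lca i j"
proof -
  have wv: "w \<in> pverts G" using arc arc_verts by blast
  have wi: "anc w i" using arc v anc_arc anc_trans by blast
  have "anc w j"
  proof (cases "w = r")
    case True
    then show ?thesis using root_anc ij by simp
  next
    case False
    with parent_exists wv obtain u where "(u, w) \<in> parcs G" by blast
    with w[of u] wi show ?thesis by (simp add: cut_def)
  qed
  with wi have up: "anc w (lca i j)" using anc_lca_iff ij by blast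
  have L: "anc (lca i j) i" "anc (lca i j) j" using lca_props[OF ij] by auto
  have "\<not> anc v (lca i j)" using v(2) L(2) anc_trans by blast
  with anc_chain[OF v(1) L(1)] have "anc (lca i j) v" "lca i j \<noteq> v" by auto
  with anc_child_cases[OF _ arc] have "anc (lca i j) w" by blast
  with up wv show ?thesis using anc_antisym by blast
qed

lemma trek_top_eq_lca:
  assumes ij: "i \<in> pverts G" "j \<in> pverts G" and p: "p \<in> treks G i j"
  shows "trek_top G p = lca i j"
  unfolding trek_top_def path_edges_trek[OF p]
proof (rule the_equality)
  let ?L = "lca i j"
  have L: "anc ?L i" "anc ?L j" using lca_props[OF ij] by auto
  have "?L \<in> set p"
  proof (cases "?L = i")
    case True
    with p show ?thesis by (auto simp: trek_iff)
  next
    case False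
    then obtain c where c: "(?L, c) \<in> parcs G" "anc c i"
      using child_towards L(1) by blast
    \<comment> \<open>Otherwise \<open>c\<close> would be a common ancestor below the lowest one. So
      the edge to \<open>c\<close> is a cut edge and lies on the path.\<close>
    have "\<not> anc c j"
      using anc_lca_iff[OF ij] c not_anc_parent by blast
    with c have "(?L, c) \<in> path_edges G p"
      unfolding path_edges_trek[OF p] by (simp add: cut_def)
    then show ?thesis using path_edges_verts by blast
  qed
  with L show "?L \<in> set p \<and> (\<forall>k. (k, ?L) \<notin> cut i j)" by (simp add: cut_def)
next
  fix w assume w: "w \<in> set p \<and> (\<forall>k. (k, w) \<notin> cut i j)"
  show "w = lca i j"
  proof (cases "p = [w]")
    case True
    with p have "i = w" "j = w" by (auto simp: trek_iff)
    with ij show ?thesis by simp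
  next
    case False
    then obtain u where "(w, u) \<in> set (vwalk_arcs p) \<or> (u, w) \<in> set (vwalk_arcs p)"
      using vertex_on_arc[of w p] w p by (auto simp: trek_iff)
    then have "(w, u) \<in> path_edges G p \<or> (u, w) \<in> path_edges G p"
      using p by (auto simp: trek_iff path_edges_def)
    \<comment> \<open>No edge of the path enters \<open>w\<close>, so its edge at \<open>w\<close>
      leaves \<open>w\<close>, leading down to \<open>i\<close> or to \<open>j\<close>.\<close>
    then have wu: "(w, u) \<in> cut i j" using w path_edges_trek[OF p] by auto
    have cut_commute: "cut j i = cut i j" by (auto simp: cut_def)
    show ?thesis
    proof (cases "anc u i")
      case True
      with wu w lca_of_cut_start[OF ij, of w u] show ?thesis by (auto simp: cut_def)
    next
      case False
      with wu w lca_of_cut_start[OF ij(2,1), of w u] show ?thesis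
        unfolding cut_commute lca_commute[of j i] by (auto simp: cut_def)
    qed
  qed
qed

definition trek_mon :: "'v \<times> 'v \<Rightarrow> 'v param \<Rightarrow>\<^sub>0 nat" where
  "trek_mon = (\<lambda>(i, j). Poly_Mapping.single (Avar (lca i j)) 1 +
     (\<Sum>(k, l)\<in>cut i j. Poly_Mapping.single (Lvar k l) 1))"

lemma trek_polynomial:
  assumes "i \<in> pverts G" "j \<in> pverts G"
  shows "(\<Sum>p\<in>treks G i j. Var (Avar (trek_top G p)) * (\<Prod>(k, l)\<in>path_edges G p. Var (Lvar k l))) =
    Poly_Mapping.single (trek_mon (i, j)) 1"
proof -
  obtain p where p: "treks G i j = {p}" using treks_singleton[OF assms] .
  then have "trek_top G p = lca i j" "path_edges G p = cut i j"
    using trek_top_eq_lca[OF assms] path_edges_trek by auto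
  moreover have "(\<Prod>(k, l)\<in>cut i j. Var (Lvar k l)) =
      Poly_Mapping.single (\<Sum>(k, l)\<in>cut i j. Poly_Mapping.single (Lvar k l) 1) (1 :: complex)"
    using prod_Var[of "\<lambda>(k, l). Lvar k l" "cut i j"] by (simp add: case_prod_unfold)
  ultimately show ?thesis
    using p by (simp add: trek_mon_def Var_def mult_single)
qed

lemma finite_cut: "finite (cut i j)"
  using finite_arcs by (rule rev_finite_subset) (auto simp: cut_def)

lemma lookup_trek_mon:
  "Poly_Mapping.lookup (trek_mon (i, j)) (Avar v) = (if v = lca i j then 1 else 0)"
  "Poly_Mapping.lookup (trek_mon (i, j)) (Lvar u v) = (if (u, v) \<in> cut i j then 1 else 0)"
proof -
  have 1: "Poly_Mapping.lookup (case e of (k, l) \<Rightarrow> Poly_Mapping.single (Lvar k l) (Suc 0)) (Avar v) = 0" for e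
    by (cases e) (simp add: lookup_single_Suc_0)
  show "Poly_Mapping.lookup (trek_mon (i, j)) (Avar v) = (if v = lca i j then 1 else 0)"
    by (simp add: trek_mon_def lookup_add lookup_sum lookup_single_Suc_0 1)
  have 2: "Poly_Mapping.lookup (case e of (k, l) \<Rightarrow> Poly_Mapping.single (Lvar k l) (Suc 0)) (Lvar u v) =
      (if e = (u, v) then 1 else 0)" for e
    by (cases e) (auto simp: lookup_single_Suc_0)
  show "Poly_Mapping.lookup (trek_mon (i, j)) (Lvar u v) = (if (u, v) \<in> cut i j then 1 else 0)"
    using finite_cut by (simp add: trek_mon_def lookup_add lookup_sum lookup_single_Suc_0 2)
qed

end

section \<open>Joins of leaves in a binary tree\<close>

locale leaf_labelled_tree = arborescence G r for G :: "nat pair_pre_digraph" and r :: nat +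
  fixes n :: nat
  assumes leaves: "leaves G = {1..n}"
    and binary: "v \<in> pverts G - leaves G \<Longrightarrow> out_degree (with_proj G) v = 2"
begin

lemma leaf_verts: "i \<in> {1..n} \<Longrightarrow> i \<in> pverts G"
  unfolding leaves[symmetric] by (simp add: leaves_def)

lemma out_degree_eq: "out_degree (with_proj G) v = card {e \<in> parcs G. fst e = v}"
  by (simp add: out_degree_def out_arcs_def)

lemma leaf_no_child: "i \<in> {1..n} \<Longrightarrow> (i, c) \<notin> parcs G"
proof
  assume i: "i \<in> {1..n}" and c: "(i, c) \<in> parcs G"
  from i have "i \<in> leaves G" unfolding leaves .
  then have "card {e \<in> parcs G. fst e = i} = 0"
    unfolding out_degree_eq[symmetric] by (simp add: leaves_def)
  then have "{e \<in> parcs G. fst e = i} = {}" using finite_arcs by simp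
  moreover have "(i, c) \<in> {e \<in> parcs G. fst e = i}" using c by simp
  ultimately show False by blast
qed

text \<open>This is where binarity enters: a vertex with a child is not a leaf and so has out-degree
  2.\<close>

lemma at_most_two_children:
  assumes "(v, a) \<in> parcs G" "(v, b) \<in> parcs G" "(v, c) \<in> parcs G"
  shows "a = b \<or> a = c \<or> b = c"
proof (rule ccontr)
  assume "\<not> ?thesis"
  then have "card {(v, a), (v, b), (v, c)} = 3" by auto
  moreover have "card {(v, a), (v, b), (v, c)} \<le> card {e \<in> parcs G. fst e = v}"
    using assms finite_arcs by (intro card_mono) auto
  moreover have "card {e \<in> parcs G. fst e = v} = 2"
    unfolding out_degree_eq[symmetric]
    using leaf_no_child assms(1) arc_verts by (intro binary) (auto simp: leaves)
  ultimately show False by simp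
qed

lemma leaf_anc: "i \<in> {1..n} \<Longrightarrow> anc i j \<Longrightarrow> j = i"
  using child_towards[of i j] leaf_no_child by blast

lemma children_of_lca:
  assumes "i \<in> {1..n}" "j \<in> {1..n}" "i \<noteq> j"
  obtains c d where "(lca i j, c) \<in> parcs G" "(lca i j, d) \<in> parcs G" "anc c i" "anc d j"
    "\<not> anc c j" "\<not> anc d i"
proof -
  note ij = leaf_verts[OF assms(1)] leaf_verts[OF assms(2)]
  have L: "anc (lca i j) i" "anc (lca i j) j" using lca_props[OF ij] by auto
  have "lca i j \<noteq> i" "lca i j \<noteq> j"
    using leaf_anc[OF assms(1), of j] leaf_anc[OF assms(2), of i] L assms(3) by auto
  obtain c where c: "(lca i j, c) \<in> parcs G" "anc c i"
    using child_towards[OF L(1) \<open>lca i j \<noteq> i\<close>] .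
  obtain d where d: "(lca i j, d) \<in> parcs G" "anc d j"
    using child_towards[OF L(2) \<open>lca i j \<noteq> j\<close>] .
  note cd = c d
  have "\<not> anc c j" "\<not> anc d i"
    using anc_lca_iff[OF ij] cd not_anc_parent by blast+
  with cd that show ?thesis by blast
qed

lemma child_unique:
  assumes "(v, c) \<in> parcs G" "(v, d) \<in> parcs G" "anc c i" "anc d i"
  shows "c = d"
  using anc_chain[OF assms(3,4)] anc_child_cases[of c d v] anc_child_cases[of d c v]
    assms(1,2) not_anc_parent by blast

definition first_child :: "nat \<Rightarrow> nat" where
  "first_child v = (SOME c. (v, c) \<in> parcs G)"

text \<open>The guard makes \<open>left_of v\<close> false everywhere if \<open>v\<close> has no
  child, when the value of \<open>first_child v\<close> is arbitrary.\<close>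

definition left_of :: "nat \<Rightarrow> nat \<Rightarrow> bool" where
  "left_of v i \<longleftrightarrow> (v, first_child v) \<in> parcs G \<and> anc (first_child v) i"

lemma first_child: "(v, c) \<in> parcs G \<Longrightarrow> (v, first_child v) \<in> parcs G"
  unfolding first_child_def by (rule someI)

text \<open>The leaves \<open>i\<close> and \<open>j\<close> lie below different children of their
  join, and as there are only two, one of these is the first child.\<close>

lemma left_of_separates:
  assumes "i \<in> {1..n}" "j \<in> {1..n}" "i \<noteq> j"
  shows "left_of (lca i j) i \<noteq> left_of (lca i j) j"
proof -
  obtain c d where cd: "(lca i j, c) \<in> parcs G" "(lca i j, d) \<in> parcs G" "anc c i" "anc d j"
    "\<not> anc c j" "\<not> anc d i" using children_of_lca[OF assms] .
  from at_most_two_children[OF first_child[OF cd(1)] cd(1,2)] cd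
  have "first_child (lca i j) = c \<or> first_child (lca i j) = d" by auto
  with cd show ?thesis by (auto simp: left_of_def)
qed

lemma lca_above_split:
  assumes ij: "i \<in> pverts G" "j \<in> pverts G"
    and c: "(v, c) \<in> parcs G" "anc c i" "\<not> anc c j"
  shows "anc (lca i j) v"
proof -
  have L: "anc (lca i j) i" "anc (lca i j) j" using lca_props[OF ij] by auto
  have "\<not> anc c (lca i j)" using c(3) L(2) anc_trans by blast
  with anc_chain[OF c(2) L(1)] anc_child_cases[OF _ c(1)] show ?thesis by auto
qed

lemma left_of_lower:
  assumes "i \<in> {1..n}" "j \<in> {1..n}" "left_of v i \<noteq> left_of v j" "v \<noteq> lca i j"
  shows "size_below v < size_below (lca i j)"
proof -
  note ij = leaf_verts[OF assms(1)] leaf_verts[OF assms(2)]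
  have "(v, first_child v) \<in> parcs G" using assms(3) by (auto simp: left_of_def)
  moreover from this have "anc (lca i j) v"
    using lca_above_split[OF ij, of v "first_child v"]
      lca_above_split[OF ij(2,1), of v "first_child v"] assms(3) lca_commute[of i j]
    by (auto simp: left_of_def)
  ultimately show ?thesis using assms(4) arc_verts by (intro size_below_less) auto
qed

text \<open>Three equal joins would put the leaves below three different children of one
  vertex.\<close>

lemma lca_ultrametric_equal:
  assumes "i \<in> {1..n}" "j \<in> {1..n}" "k \<in> {1..n}" "i \<noteq> j" "i \<noteq> k" "j \<noteq> k"
    and eq: "lca i j = lca i k"
  shows "size_below (lca j k) < size_below (lca i j)"
proof (rule size_below_less)
  note v = leaf_verts[OF assms(1)] leaf_verts[OF assms(2)] leaf_verts[OF assms(3)]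
  show "anc (lca i j) (lca j k)"
    using anc_lca_iff[OF v(2,3)] lca_props[OF v(1,2)] lca_props[OF v(1,3)] eq by simp
  show "lca j k \<in> pverts G" using lca_in_verts v by blast
  show "lca i j \<noteq> lca j k"
  proof
    assume eq': "lca i j = lca j k"
    obtain a b where ab: "(lca i j, a) \<in> parcs G" "(lca i j, b) \<in> parcs G" "anc a i" "anc b j"
      "\<not> anc a j" "\<not> anc b i" using children_of_lca[OF assms(1,2,4)] .
    obtain a' c where ac: "(lca i k, a') \<in> parcs G" "(lca i k, c) \<in> parcs G" "anc a' i" "anc c k"
      "\<not> anc a' k" "\<not> anc c i" using children_of_lca[OF assms(1,3,5)] .
    obtain b' c' where bc: "(lca j k, b') \<in> parcs G" "(lca j k, c') \<in> parcs G" "anc b' j" "anc c' k"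
      "\<not> anc b' k" "\<not> anc c' j" using children_of_lca[OF assms(2,3,6)] .
    have "b' = b" using child_unique[of "lca i j" b' b j] ab bc eq' by simp
    with at_most_two_children[of "lca i j" a b c] ab ac bc eq show False by auto
  qed
qed

text \<open>The joins \<open>lca i j\<close> and \<open>lca i k\<close> are both above
  \<open>i\<close> and hence comparable. If they differ, the higher one is also the join of
  \<open>j\<close> and \<open>k\<close>.\<close>

lemma lca_ultrametric:
  assumes "i \<in> {1..n}" "j \<in> {1..n}" "k \<in> {1..n}" "i \<noteq> j" "i \<noteq> k" "j \<noteq> k"
  shows "lca i j = lca i k \<and> size_below (lca j k) < size_below (lca i j) \<or>
    lca i j = lca j k \<and> size_below (lca i k) < size_below (lca i j) \<or>
    lca i k = lca j k \<and> size_below (lca i j) < size_below (lca i k)"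
proof -
  note v = leaf_verts[OF assms(1)] leaf_verts[OF assms(2)] leaf_verts[OF assms(3)]
  have below: "lca i j = lca j k \<and> size_below (lca i k) < size_below (lca i j)"
    if v: "i \<in> pverts G" "j \<in> pverts G" "k \<in> pverts G"
      and above: "anc (lca i j) (lca i k)" "lca i j \<noteq> lca i k" for i j k
  proof -
    note ij = lca_props[OF v(1,2)] and ik = lca_props[OF v(1,3)] and jk = lca_props[OF v(2,3)]
    have "anc (lca i j) k" using above(1) ik anc_trans by blast
    then have 1: "anc (lca i j) (lca j k)" using ij jk by simp
    \<comment> \<open>Otherwise \<open>lca i k\<close> would be above both \<open>i\<close> and
      \<open>j\<close>, hence above \<open>lca i j\<close>, which is strictly higher.\<close>
    have "\<not> anc (lca i k) (lca j k)"
    proof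
      assume "anc (lca i k) (lca j k)"
      then have "anc (lca i k) j" using jk anc_trans by blast
      with ij ik have "anc (lca i k) (lca i j)" by simp
      then show False using above anc_antisym lca_in_verts[OF v(1,3)] by blast
    qed
    moreover have "anc (lca i k) k" "anc (lca j k) k" using ik jk by simp_all
    ultimately have "anc (lca j k) (lca i k)" using anc_chain by blast
    then have "anc (lca j k) i" using ik anc_trans by blast
    then have 2: "anc (lca j k) (lca i j)" using ij jk by simp
    have "lca i j = lca j k" by (rule anc_antisym[OF 1 2 lca_in_verts[OF v(2,3)]])
    then show ?thesis using size_below_less[OF above lca_in_verts[OF v(1,3)]] by simp
  qed
  have chain: "anc (lca i j) (lca i k) \<or> anc (lca i k) (lca i j)"
    using anc_chain[of "lca i j" i "lca i k"] lca_props[OF v(1,2)] lca_props[OF v(1,3)] by blast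
  show ?thesis
  proof (cases "lca i j = lca i k")
    case True
    with lca_ultrametric_equal[OF assms] show ?thesis by simp
  next
    case False
    from chain show ?thesis
    proof
      assume "anc (lca i j) (lca i k)"
      from below[OF v this False] show ?thesis by blast
    next
      assume "anc (lca i k) (lca i j)"
      from below[OF v(1,3,2) this] False
      have "lca i k = lca j k \<and> size_below (lca i j) < size_below (lca i k)"
        by (simp only: lca_commute[of k j])
      then show ?thesis by blast
    qed
  qed
qed

sublocale leaf_joins n "pverts G" lca size_below left_of
proof
  show "finite (pverts G)" by (rule finite_verts)
  show "lca i j = lca j i" for i j by (rule lca_commute)
  show "lca i j \<in> pverts G" if "i \<in> {1..n}" "j \<in> {1..n}" for i j
    using that leaf_verts lca_in_verts by blast
  show diag: "j = i \<and> k = i" if "i \<in> {1..n}" "j \<in> {1..n}" "k \<in> {1..n}" "lca i i = lca j k" for i j k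
  proof -
    have "lca j k = i" using that leaf_verts lca_self by metis
    with lca_props[of j k] that leaf_verts leaf_anc show ?thesis by metis
  qed
  show "size_below (lca i i) < size_below (lca i j)" if ij: "i \<in> {1..n}" "j \<in> {1..n}" "i \<noteq> j" for i j
  proof -
    have "lca i j \<noteq> i" using diag[of i i j] ij leaf_verts lca_self by metis
    with size_below_less[of "lca i j" i] ij leaf_verts lca_props lca_self show ?thesis by metis
  qed
  show "size_below (lca i k) \<le> size_below (lca i j)"
    if "i \<in> {1..n}" "j \<in> {1..n}" "k \<in> {1..n}" "l \<in> {1..n}" "lca i j = lca k l" for i j k l
  proof (rule size_below_le)
    note v = leaf_verts[OF that(1)] leaf_verts[OF that(2)] leaf_verts[OF that(3)] leaf_verts[OF that(4)]
    show "anc (lca i j) (lca i k)"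
      using anc_lca_iff[OF v(1,3)] lca_props[OF v(1,2)] lca_props[OF v(3,4)] that(5) by simp
    show "lca i k \<in> pverts G" using v lca_in_verts by blast
  qed
  show "lca i j = lca i k \<and> size_below (lca j k) < size_below (lca i j) \<or>
      lca i j = lca j k \<and> size_below (lca i k) < size_below (lca i j) \<or>
      lca i k = lca j k \<and> size_below (lca i j) < size_below (lca i k)"
    if "i \<in> {1..n}" "j \<in> {1..n}" "k \<in> {1..n}" "i \<noteq> j" "i \<noteq> k" "j \<noteq> k" for i j k
    using that by (rule lca_ultrametric)
  show "left_of (lca i j) i \<noteq> left_of (lca i j) j" if "i \<in> {1..n}" "j \<in> {1..n}" "i \<noteq> j" for i j
    using that by (rule left_of_separates)
  show "size_below v < size_below (lca i j)"
    if "i \<in> {1..n}" "j \<in> {1..n}" "left_of v i \<noteq> left_of v j" "v \<noteq> lca i j" for i j v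
    using that by (rule left_of_lower)
qed

end

section \<open>The trek ideal as an initial ideal\<close>

text \<open>The sign action is a monomial map that fixes exponents, so its fibres are single
  monomials.\<close>

lemma lookup_sign_action:
  "Poly_Mapping.lookup (sign_action \<tau> f) m = Poly_Mapping.lookup f m * monomial_eval \<tau> m"
proof -
  have expo_id: "expo (\<lambda>x. Poly_Mapping.single x (Suc 0)) m = m" for m :: "'a \<Rightarrow>\<^sub>0 nat"
    by (induction m rule: monomial_induct) (simp_all add: expo_add)
  have "sign_action \<tau> f = subst_hom (\<lambda>x. Poly_Mapping.single (Poly_Mapping.single x (Suc 0)) (\<tau> x)) f"
    by (simp add: sign_action_def Var_def)
  then have "Poly_Mapping.lookup (sign_action \<tau> f) m =
      (\<Sum>m' | m' \<in> Poly_Mapping.keys f \<and> m' = m. Poly_Mapping.lookup f m' * monomial_eval \<tau> m')"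
    by (simp only: lookup_subst_hom_term expo_id)
  also have "{m'. m' \<in> Poly_Mapping.keys f \<and> m' = m} = (if m \<in> Poly_Mapping.keys f then {m} else {})"
    by auto
  finally show ?thesis by (simp add: in_keys_iff)
qed

lemma sign_action_involution:
  assumes "\<And>x. \<tau> x \<in> {1, -1}"
  shows "sign_action \<tau> (sign_action \<tau> f) = f"
  by (rule poly_mapping_eqI) (simp add: lookup_sign_action mult.assoc monomial_eval_sign[OF assms])

lemma keys_sign_action:
  assumes "\<And>x. \<tau> x \<in> {1, -1}"
  shows "Poly_Mapping.keys (sign_action \<tau> f) = Poly_Mapping.keys f"
proof -
  have "monomial_eval \<tau> m \<noteq> 0" for m
    using monomial_eval_sign[of \<tau> m, OF assms] by auto
  then show ?thesis by (auto simp: in_keys_iff lookup_sign_action)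
qed

text \<open>Signs in the images of the variables are traded for signs in the polynomial; this
  relates the kernel of the twisted monomial map to that of the plain one.\<close>

lemma subst_hom_sign_action:
  assumes "\<And>x. \<tau> x \<in> {1, -1}"
  shows "subst_hom (\<lambda>x. Poly_Mapping.single (E x) 1) (sign_action \<tau> f) =
    subst_hom (\<lambda>x. Poly_Mapping.single (E x) (\<tau> x)) f"
proof (rule poly_mapping_eqI)
  fix e
  show "Poly_Mapping.lookup (subst_hom (\<lambda>x. Poly_Mapping.single (E x) 1) (sign_action \<tau> f)) e =
      Poly_Mapping.lookup (subst_hom (\<lambda>x. Poly_Mapping.single (E x) (\<tau> x)) f) e"
    unfolding lookup_subst_hom_term keys_sign_action[OF assms] lookup_sign_action
    by (simp add: monomial_eval_def)
qed

context leaf_labelled_tree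
begin

section \<open>Trek exponents versus join exponents\<close>

lemma keys_leaf_pair:
  assumes "Poly_Mapping.keys m \<subseteq> X" "(a, b) \<in> Poly_Mapping.keys m"
  shows "a \<in> {1..n}" "b \<in> {1..n}"
  using assms by (auto simp: sigma_vars_def)

lemma lookup_join_mon:
  "Poly_Mapping.lookup (join_mon (a, b)) (Inl i) = (if i = a then 1 else 0) + (if i = b then 1 else 0)"
  "Poly_Mapping.lookup (join_mon (a, b)) (Inr v) = (if v = lca a b then 1 else 0)"
  by (auto simp: join_mon_def lookup_add lookup_single_Suc_0)

text \<open>For a vertex \<open>v\<close> other than the root this is the exponent, in the image of
  \<open>m\<close> under the trek map, of the edge variable with head \<open>v\<close>.\<close>

definition cut_count :: "nat \<Rightarrow> (nat \<times> nat \<Rightarrow>\<^sub>0 nat) \<Rightarrow> nat" where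
  "cut_count v m = (\<Sum>(a, b)\<in>Poly_Mapping.keys m.
     Poly_Mapping.lookup m (a, b) * (if anc v a \<noteq> anc v b then 1 else 0))"

text \<open>
  An edge into \<open>v\<close> is on the trek from \<open>a\<close> to \<open>b\<close> iff exactly one of \<open>a\<close>, \<open>b\<close> is below \<open>v\<close>, and
  both are below \<open>v\<close> iff their lowest common ancestor is.
\<close>

lemma cut_count_eq:
  assumes m: "Poly_Mapping.keys m \<subseteq> X"
  shows "cut_count v m + 2 * (\<Sum>w | w \<in> pverts G \<and> anc v w. Poly_Mapping.lookup (expo join_mon m) (Inr w)) =
    (\<Sum>i | i \<in> {1..n} \<and> anc v i. Poly_Mapping.lookup (expo join_mon m) (Inl i))"
proof -
  let ?A = "{w. w \<in> pverts G \<and> anc v w}" and ?B = "{i. i \<in> {1..n} \<and> anc v i}"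
  let ?l = "Poly_Mapping.lookup m" and ?j = "\<lambda>x. Poly_Mapping.lookup (join_mon x)"
  have fin: "finite ?A" "finite ?B" using finite_verts by auto
  \<comment> \<open>For a single variable, every end below \<open>v\<close> counts once, and a pair
    of ends below \<open>v\<close> is recorded by its join, whence the factor 2.\<close>
  have "(if anc v a \<noteq> anc v b then 1 else 0) + 2 * (\<Sum>w\<in>?A. ?j (a, b) (Inr w)) =
      (\<Sum>i\<in>?B. ?j (a, b) (Inl i))" if "(a, b) \<in> Poly_Mapping.keys m" for a b
  proof -
    note ab = keys_leaf_pair[OF m that]
    have "(\<Sum>i\<in>?B. ?j (a, b) (Inl i)) = (if anc v a then 1 else 0) + (if anc v b then 1 else 0)"
      using fin ab by (simp add: lookup_join_mon sum.distrib)
    moreover have "(\<Sum>w\<in>?A. ?j (a, b) (Inr w)) = (if anc v a \<and> anc v b then 1 else 0)"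
      using fin lca_in_verts[OF ab[THEN leaf_verts]] anc_lca_iff[OF ab[THEN leaf_verts]]
      by (simp add: lookup_join_mon)
    ultimately show ?thesis by simp
  qed
  then have pointwise: "(if anc v (fst x) \<noteq> anc v (snd x) then 1 else 0) + 2 * (\<Sum>w\<in>?A. ?j x (Inr w)) =
      (\<Sum>i\<in>?B. ?j x (Inl i))" if "x \<in> Poly_Mapping.keys m" for x
    using that by (cases x) simp
  have "cut_count v m + 2 * (\<Sum>w\<in>?A. Poly_Mapping.lookup (expo join_mon m) (Inr w)) =
      (\<Sum>x\<in>Poly_Mapping.keys m. ?l x * ((if anc v (fst x) \<noteq> anc v (snd x) then 1 else 0) +
        2 * (\<Sum>w\<in>?A. ?j x (Inr w))))"
    unfolding cut_count_def lookup_expo sum.swap[of _ _ ?A]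
    by (simp add: case_prod_unfold sum_distrib_left sum.distrib distrib_left mult.left_commute)
  also have "\<dots> = (\<Sum>x\<in>Poly_Mapping.keys m. ?l x * (\<Sum>i\<in>?B. ?j x (Inl i)))"
    by (rule sum.cong[OF refl]) (simp only: pointwise)
  also have "\<dots> = (\<Sum>i\<in>?B. Poly_Mapping.lookup (expo join_mon m) (Inl i))"
    unfolding lookup_expo sum.swap[of _ _ ?B] by (simp add: sum_distrib_left)
  finally show ?thesis .
qed

lemma lookup_expo_trek_mon:
  "Poly_Mapping.lookup (expo trek_mon m) (Avar v) = Poly_Mapping.lookup (expo join_mon m) (Inr v)"
  "Poly_Mapping.lookup (expo trek_mon m) (Lvar u v) = (if (u, v) \<in> parcs G then cut_count v m else 0)"
proof -
  have A: "Poly_Mapping.lookup (trek_mon x) (Avar v) = Poly_Mapping.lookup (join_mon x) (Inr v)" for x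
    by (cases x) (simp only: lookup_trek_mon lookup_join_mon)
  show "Poly_Mapping.lookup (expo trek_mon m) (Avar v) = Poly_Mapping.lookup (expo join_mon m) (Inr v)"
    by (simp add: lookup_expo A)
  have L: "Poly_Mapping.lookup (trek_mon x) (Lvar u v) =
      (if (u, v) \<in> parcs G then if anc v (fst x) \<noteq> anc v (snd x) then 1 else 0 else 0)" for x
    by (cases x) (auto simp: lookup_trek_mon cut_def)
  show "Poly_Mapping.lookup (expo trek_mon m) (Lvar u v) = (if (u, v) \<in> parcs G then cut_count v m else 0)"
    by (simp add: lookup_expo L cut_count_def case_prod_unfold)
qed

text \<open>By the identity for \<open>cut_count\<close>, leaf degrees and joins determine the cut
  counts. Conversely, at a leaf the identity recovers its degree from the cut count and the
  joins.\<close>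

lemma expo_trek_mon_eq_iff:
  assumes m: "Poly_Mapping.keys m \<subseteq> X" "Poly_Mapping.keys m' \<subseteq> X"
  shows "expo trek_mon m = expo trek_mon m' \<longleftrightarrow> expo join_mon m = expo join_mon m'"
proof
  assume eq: "expo join_mon m = expo join_mon m'"
  have "cut_count v m = cut_count v m'" for v
    using cut_count_eq[OF m(1), of v] cut_count_eq[OF m(2), of v] unfolding eq by linarith
  then have "Poly_Mapping.lookup (expo trek_mon m) y = Poly_Mapping.lookup (expo trek_mon m') y" for y
    using eq by (cases y) (simp_all only: lookup_expo_trek_mon)
  then show "expo trek_mon m = expo trek_mon m'" by (rule poly_mapping_eqI)
next
  assume eq: "expo trek_mon m = expo trek_mon m'"
  have joins: "Poly_Mapping.lookup (expo join_mon m) (Inr v) = Poly_Mapping.lookup (expo join_mon m') (Inr v)" for v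
    using eq by (simp only: lookup_expo_trek_mon(1)[symmetric])
  have cuts: "cut_count v m = cut_count v m'" if v: "v \<in> pverts G" for v
  proof (cases "v = r")
    case True
    \<comment> \<open>No edge variable records a cut at the root, but the root is above every leaf,
      so the count is 0.\<close>
    have "cut_count r m = 0" if "Poly_Mapping.keys m \<subseteq> X" for m
      unfolding cut_count_def using keys_leaf_pair[OF that] leaf_verts root_anc
      by (intro sum.neutral) auto
    with m True show ?thesis by simp
  next
    case False
    then obtain u where "(u, v) \<in> parcs G" using parent_exists v by blast
    then show ?thesis using lookup_expo_trek_mon(2)[of _ u v] eq by metis
  qed
  have degrees: "Poly_Mapping.lookup (expo join_mon m) (Inl i) = Poly_Mapping.lookup (expo join_mon m') (Inl i)" for i
  proof (cases "i \<in> {1..n}")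
    case True
    \<comment> \<open>Only \<open>i\<close> is below the leaf \<open>i\<close>, so the sum of
      degrees in \<open>cut_count_eq\<close> is a single degree.\<close>
    then have "{k. k \<in> {1..n} \<and> anc i k} = {i}" using leaf_anc by auto
    with cut_count_eq[OF m(1), of i] cut_count_eq[OF m(2), of i] cuts[OF leaf_verts[OF True]] joins
    show ?thesis by simp
  next
    case False
    have "Poly_Mapping.lookup (expo join_mon m) (Inl i) = 0" if "Poly_Mapping.keys m \<subseteq> X" for m
      unfolding lookup_expo
    proof (rule sum.neutral, rule ballI)
      fix x assume "x \<in> Poly_Mapping.keys m"
      with keys_leaf_pair[OF that] False
      show "Poly_Mapping.lookup m x * Poly_Mapping.lookup (join_mon x) (Inl i) = 0"
        by (cases x) (auto simp: lookup_join_mon)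
    qed
    with m show ?thesis by simp
  qed
  show "expo join_mon m = expo join_mon m'"
  proof (rule poly_mapping_eqI)
    fix y show "Poly_Mapping.lookup (expo join_mon m) y = Poly_Mapping.lookup (expo join_mon m') y"
      using joins degrees by (cases y) simp_all
  qed
qed

lemma sigma_vars_leaves: "X \<subseteq> sigma_vars (pverts G)"
  using leaf_verts by (auto simp: sigma_vars_def)

lemma observed_trek_ideal_eq:
  "observed_trek_ideal G {1..n} =
     {f \<in> carrier (poly_ring X). subst_hom (\<lambda>p. Poly_Mapping.single (join_mon p) 1) f = 0}"
proof -
  have "trek_hom G f = 0 \<longleftrightarrow> subst_hom (\<lambda>p. Poly_Mapping.single (join_mon p) 1) f = 0"
    if f: "f \<in> carrier (poly_ring X)" for f
  proof -
    have "trek_hom G f = subst_hom (\<lambda>p. Poly_Mapping.single (trek_mon p) 1) f"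
      unfolding trek_hom_def
    proof (rule subst_hom_cong)
      fix m x assume "m \<in> Poly_Mapping.keys f" "x \<in> Poly_Mapping.keys m"
      with f have "x \<in> X" unfolding in_carrier_poly_ring by blast
      then obtain i j where x: "x = (i, j)" "i \<in> {1..n}" "j \<in> {1..n}"
        by (auto simp: sigma_vars_def)
      show "(case x of (i, j) \<Rightarrow> \<Sum>p\<in>treks G i j. Var (Avar (trek_top G p)) *
          (\<Prod>(k, l)\<in>path_edges G p. Var (Lvar k l))) = Poly_Mapping.single (trek_mon x) 1"
        unfolding x(1) prod.case by (rule trek_polynomial[OF leaf_verts[OF x(2)] leaf_verts[OF x(3)]])
    qed
    moreover have "subst_hom (\<lambda>p. Poly_Mapping.single (trek_mon p) 1) f = 0 \<longleftrightarrow>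
        subst_hom (\<lambda>p. Poly_Mapping.single (join_mon p) 1) f = 0"
      using f by (intro monomial_kernel_eqI expo_trek_mon_eq_iff) (auto simp: in_carrier_poly_ring)
    ultimately show ?thesis by simp
  qed
  moreover have "carrier (poly_ring X) \<subseteq> carrier (poly_ring (sigma_vars (pverts G)))"
    using sigma_vars_leaves unfolding subset_iff in_carrier_poly_ring by blast
  ultimately show ?thesis
    unfolding observed_trek_ideal_def trek_ideal_def a_kernel_def' by auto
qed

lemma observed_trek_ideal_eq_sign_action:
  "observed_trek_ideal G {1..n} =
     sign_action join_sign ` initial_ideal X weight (grassmannian_ideal n)"
proof -
  note inv = sign_action_involution[of join_sign, OF join_sign_cases]
    and keys = keys_sign_action[of join_sign, OF join_sign_cases]
  \<comment> \<open>The action is its own inverse, so membership in an image can be tested as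
    membership in a preimage.\<close>
  have mem: "sign_action join_sign f \<in> initial \<longleftrightarrow> f \<in> observed_trek_ideal G {1..n}" for f
    unfolding initial_eq_kernel observed_trek_ideal_eq mem_Collect_eq in_carrier_poly_ring keys
    using subst_hom_sign_action[of join_sign join_mon "sign_action join_sign f", OF join_sign_cases]
    by (simp add: inv signed_join_def[abs_def])
  show ?thesis
    unfolding initial_def[symmetric]
  proof
    show "observed_trek_ideal G {1..n} \<subseteq> sign_action join_sign ` initial"
    proof
      fix f assume "f \<in> observed_trek_ideal G {1..n}"
      then have "sign_action join_sign f \<in> initial" by (simp only: mem)
      then show "f \<in> sign_action join_sign ` initial" using inv[of f] by (metis imageI)
    qed
    show "sign_action join_sign ` initial \<subseteq> observed_trek_ideal G {1..n}"
    proof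
      fix f assume "f \<in> sign_action join_sign ` initial"
      then obtain g where "f = sign_action join_sign g" "g \<in> initial" by blast
      then show "f \<in> observed_trek_ideal G {1..n}" using mem[of f] inv[of g] by simp
    qed
  qed
qed

end

theorem theorem7p1:
  fixes T :: "nat pair_pre_digraph" and n :: nat
  assumes "rooted_binary_tree T"
    and "leaves T = {1..n}"
  shows "\<exists>(\<omega> :: nat \<times> nat \<Rightarrow> real) (\<tau> :: nat \<times> nat \<Rightarrow> complex).
           (\<forall>x\<in>sigma_vars {1..n}. \<tau> x \<in> {1, -1}) \<and>
           observed_trek_ideal T {1..n} =
             sign_action \<tau> ` initial_ideal (sigma_vars {1..n}) \<omega> (grassmannian_ideal n)"
proof -
  obtain r where r: "rooted_tree T r"
    using assms(1) by (auto simp: rooted_binary_tree_def)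
  interpret leaf_labelled_tree T r n
  proof
    show "rooted_tree T r" by (rule r)
    show "leaves T = {1..n}" by (rule assms(2))
    show "out_degree (with_proj T) v = 2" if "v \<in> pverts T - leaves T" for v
      using assms(1) that by (simp only: rooted_binary_tree_def)
  qed
  \<comment> \<open>The witnesses are \<open>weight\<close>, the number of vertices below the lowest
    common ancestor, and \<open>join_sign\<close>.\<close>
  show ?thesis
    using observed_trek_ideal_eq_sign_action join_sign_cases by blast
qed

end
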